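(* If $f\in L^1(\mathbb{R})$ is such that $\int_{\mathbb{R}}f(y)\,dy\neq0$, then the Hilbert transform of $f$, $$g(x)=\mathrm{p.v.}\int_{\mathbb{R}}\frac{f(y)}{y-x}\,dy,$$ is not in $L^1_{w,0}(\mathbb{R})$, and in particular, $g$ is not integrable on $\mathbb{R}$.
   Context: $L^1_{w,0}(\mathbb{R})$ is the set of all measurable functions $h$ on $\mathbb{R}$ such that $\big|\{x\in\mathbb{R}:|h(x)|>t\}\big|=o(1/t)$ both as $t\to\infty$ and as $t\to0^+$, where $|\cdot|$ of a set denotes Lebesgue measure. The principal value exists for a.e. $x\in\mathbb{R}$. *)

theory Defs
  imports "HOL-Analysis.Analysis" "HOL-Library.Landau_Symbols"
begin

text \<open>
  The principal value of the integral of \<open>\<phi>\<close> over the real line, with a singularity at \<open>x\<close>: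
  the limit, as \<open>\<epsilon>\<close> decreases to 0, of the integrals over the complement of the symmetric
  interval \<open>[x - \<epsilon>, x + \<epsilon>]\<close>. There is no truncation at infinity. Where the limit does not
  exist, \<open>Lim\<close> yields an unspecified value, the same at all such points.
\<close>

definition pv_integral :: "(real \<Rightarrow> complex) \<Rightarrow> real \<Rightarrow> complex" where
  "pv_integral \<phi> x =
     Lim (at_right 0) (\<lambda>\<epsilon>::real. set_lebesgue_integral lebesgue {y. \<epsilon> < \<bar>y - x\<bar>} \<phi>)"

text \<open>
  The kernel is \<open>1 / (y - x)\<close>, with no factor \<open>1 / \<pi>\<close>. For integrable \<open>f\<close> the
  principal value exists at almost every \<open>x\<close>, so the function below is determined up to a null set.
\<close>

definition hilbert_transform :: "(real \<Rightarrow> complex) \<Rightarrow> real \<Rightarrow> complex" where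
  "hilbert_transform f x = pv_integral (\<lambda>y. f y / complex_of_real (y - x)) x"

text \<open>
  In the next definition, the condition that the level sets have finite measure is part of the
  meaning of \<open>o(1/t)\<close>: it is needed because \<open>measure\<close> is 0 on sets of infinite measure.
  Since the level sets decrease in \<open>t\<close>, finiteness for all small \<open>t > 0\<close> is the same as
  finiteness for all \<open>t > 0\<close>.
\<close>

definition weak_L1_0 :: "(real \<Rightarrow> complex) set" where
  "weak_L1_0 = {h. h \<in> borel_measurable lebesgue \<and>
     (\<forall>t>0. emeasure lebesgue {x. t < cmod (h x)} < \<infinity>) \<and>
     (\<lambda>t. measure lebesgue {x. t < cmod (h x)}) \<in> o[at_top](\<lambda>t. 1 / t) \<and>
     (\<lambda>t. measure lebesgue {x. t < cmod (h x)}) \<in> o[at_right 0](\<lambda>t. 1 / t)}"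

end

theory Submission
  imports Defs "HOL-Real_Asymp.Real_Asymp"
begin

text \<open>
If \<open>f\<close> is supported in \<open>[-R, R]\<close>, then far away its Hilbert transform looks like that of a point mass,
\<open>- (1 / x) \<integral> f\<close>, so the set where its modulus exceeds a small height \<open>t\<close> has measure at least of order
\<open>\<bar>\<integral> f\<bar> / t\<close>. This contradicts \<open>o(1 / t)\<close> as \<open>t\<close> tends to \<open>0\<close>. A general integrable \<open>f\<close> is split into
a part with bounded support and a remainder of small \<open>L\<^sup>1\<close> norm \<open>\<delta>\<close>; by the weak type \<open>(1, 1)\<close> inequality
the remainder exceeds \<open>t\<close> only on a set of measure at most a constant times \<open>\<delta> / t\<close>, which is too small to
destroy the lower bound (\<open>superlevel_lower_bound\<close>). An integrable function satisfies the \<open>o(1 / t)\<close>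
condition at \<open>0\<close> by dominated convergence, which gives the second half of the conclusion.

The principal value is defined as a \<open>Lim\<close>, whose value is arbitrary where the limit fails to exist, so
existence almost everywhere has to be proved. It follows from the same weak type inequality, provided
that the inequality is proved for the supremum over all truncations (\<open>trunc_hilbert_maximal\<close>): the
functions for which the truncations are Cauchy at almost every point are then closed in \<open>L\<^sup>1\<close>, and they
contain the Lipschitz functions, for which the oddness of the kernel removes the singularity.

The maximal inequality is proved by real-variable means. For a finite sum of point masses of total mass
\<open>A\<close>, the function \<open>\<Sum> w s / (s - x)\<close> exceeds \<open>t\<close> on a set of measure at most
\<open>A / t\<close>: this is Boole's estimate, which comes from comparing the roots of a polynomial with its poles (\<open>boole\<close>). Cotlar's
argument (\<open>cotlar_density\<close>) bounds the truncations by this sum: if a truncation at \<open>x\<close> is large, then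
either some interval around \<open>x\<close> carries much mass, or the untruncated sum is large on a fixed proportion
of an interval around \<open>x\<close>. Vitali's covering lemma bounds the measure of both sets
(\<open>maximal_weak_type\<close>). For an integrable \<open>f \<ge> 0\<close>, moving the mass to the grid \<open>\<int> / n\<close> gives
finite sums whose truncations converge pointwise to those of \<open>f\<close>, and the bound passes to the limit.
\<close>

section \<open>Outer bounds for Lebesgue measure\<close>

text \<open>
The exceptional sets of maximal operators are unions over uncountably many radii. Working with a
measurable superset of finite measure avoids any measurability question for them.
\<close>

definition outer_measure_le :: "real set \<Rightarrow> real \<Rightarrow> bool" where
  "outer_measure_le X m \<longleftrightarrow> (\<exists>B\<in>fmeasurable lborel. X \<subseteq> B \<and> measure lborel B \<le> m)"

lemma outer_measure_leI:
  assumes "X \<subseteq> B" "B \<in> fmeasurable lborel" "measure lborel B \<le> m"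
  shows "outer_measure_le X m"
  using assms unfolding outer_measure_le_def by blast

lemma outer_measure_le_mono: "outer_measure_le Y m \<Longrightarrow> X \<subseteq> Y \<Longrightarrow> m \<le> m' \<Longrightarrow> outer_measure_le X m'"
  unfolding outer_measure_le_def by (meson order_trans)

lemma outer_measure_le_Un:
  assumes "outer_measure_le X m" "outer_measure_le Y n"
  shows "outer_measure_le (X \<union> Y) (m + n)"
proof -
  obtain A B where A: "A \<in> fmeasurable lborel" "X \<subseteq> A" "measure lborel A \<le> m"
    and B: "B \<in> fmeasurable lborel" "Y \<subseteq> B" "measure lborel B \<le> n"
    using assms unfolding outer_measure_le_def by blast
  have "measure lborel (A \<union> B) \<le> measure lborel A + measure lborel B"
    using A B by (intro measure_Un_le) auto
  then show ?thesis
    using A B by (intro outer_measure_leI[of _ "A \<union> B"]) auto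
qed

lemma outer_measure_le_uminus:
  assumes "outer_measure_le X m" shows "outer_measure_le {x. - x \<in> X} m"
proof -
  obtain B where B: "B \<in> fmeasurable lborel" "X \<subseteq> B" "measure lborel B \<le> m"
    using assms unfolding outer_measure_le_def by blast
  then have b: "B \<in> sets borel" by auto
  have "emeasure lborel B = emeasure (distr lborel borel uminus) B"
    by (simp add: lborel_distr_uminus)
  also have "\<dots> = emeasure lborel (uminus -` B)"
    using b by (subst emeasure_distr) auto
  finally have e: "emeasure lborel B = emeasure lborel (uminus -` B)" .
  have "uminus -` B \<in> sets borel"
    using b measurable_sets[of "uminus :: real \<Rightarrow> real" borel borel B] by simp
  with e B have "uminus -` B \<in> fmeasurable lborel" "measure lborel (uminus -` B) \<le> m"
    by (auto simp: fmeasurable_def measure_def)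
  then show ?thesis using B(2) by (intro outer_measure_leI[of _ "uminus -` B"]) auto
qed

lemma outer_measure_le_measurable:
  assumes "outer_measure_le X m" "X \<in> sets borel"
  shows "X \<in> fmeasurable lborel" "measure lborel X \<le> m"
proof -
  obtain B where B: "B \<in> fmeasurable lborel" "X \<subseteq> B" "measure lborel B \<le> m"
    using assms unfolding outer_measure_le_def by blast
  have X: "X \<in> sets lborel" using assms(2) by simp
  show "X \<in> fmeasurable lborel"
    by (rule fmeasurableI2[OF B(1,2) X])
  have "measure lborel X \<le> measure lborel B"
    by (rule measure_mono_fmeasurable[OF B(2) X B(1)])
  then show "measure lborel X \<le> m" using B by simp
qed

text \<open>
Fatou's lemma for sets, in the form needed to pass a weak type bound to a pointwise limit.
\<close>

lemma outer_measure_le_eventually: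
  assumes "\<And>n::nat. outer_measure_le (X n) m"
  shows "outer_measure_le {x. eventually (\<lambda>n. x \<in> X n) sequentially} m"
proof -
  have "\<forall>n. \<exists>B. B \<in> fmeasurable lborel \<and> X n \<subseteq> B \<and> measure lborel B \<le> m"
    using assms unfolding outer_measure_le_def by blast
  then obtain B where B: "\<And>n. B n \<in> fmeasurable lborel" "\<And>n. X n \<subseteq> B n" "\<And>n. measure lborel (B n) \<le> m"
    by metis
  define L where "L N = (\<Inter>n\<in>{N..}. B n)" for N
  have LB: "L N \<subseteq> B N" for N by (auto simp: L_def)
  have "L N \<in> sets lborel" for N
    unfolding L_def using fmeasurableD[OF B(1)] by (intro sets.countable_INT') auto
  then have L: "L N \<in> fmeasurable lborel" for N
    using fmeasurableI2[OF B(1) LB] by blast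
  have "(\<Union>i\<le>n. L i) \<subseteq> L n" for n by (auto simp: L_def)
  then have "(\<Union>i\<le>n. L i) = L n" for n by blast
  then have bd: "measure lborel (\<Union>i\<le>n. L i) \<le> m" for n
    using measure_mono_fmeasurable[OF LB fmeasurableD[OF L] B(1), of n] B(3)[of n] by simp
  show ?thesis
  proof (rule outer_measure_leI)
    show "{x. eventually (\<lambda>n. x \<in> X n) sequentially} \<subseteq> (\<Union>i. L i)"
      using B(2) by (fastforce simp: eventually_sequentially L_def)
    show "(\<Union>i. L i) \<in> fmeasurable lborel" using fmeasurable_countable_Union[OF L bd] .
    show "measure lborel (\<Union>i. L i) \<le> m" using measure_countable_Union_le[OF L bd] .
  qed
qed

lemma outer_measure_le_arbitrary_imp_AE:
  assumes "\<And>e. 0 < e \<Longrightarrow> outer_measure_le {x. \<not> P x} e"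
  shows "AE x in lborel. P x"
proof -
  have "negligible {x. \<not> P x}"
    unfolding negligible_outer_le
  proof (intro allI impI)
    fix e :: real assume "0 < e"
    then obtain B where B: "B \<in> fmeasurable lborel" "{x. \<not> P x} \<subseteq> B" "measure lborel B \<le> e"
      using assms unfolding outer_measure_le_def by blast
    then have "B \<in> lmeasurable" "measure lebesgue B \<le> e"
      by (auto simp: fmeasurable_def measure_completion)
    with B(2) show "\<exists>T. {x. \<not> P x} \<subseteq> T \<and> T \<in> lmeasurable \<and> measure lebesgue T \<le> e" by blast
  qed
  then have "{x. \<not> P x} \<in> null_sets lebesgue"
    by (simp add: negligible_iff_null_sets)
  then have "AE x in lebesgue. P x"
    by (rule AE_I') auto
  then show ?thesis by (simp add: AE_completion_iff)
qed

lemma AE_imp_outer_le_0: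
  assumes "AE x in lborel. P x" shows "outer_measure_le {x. \<not> P x} 0"
proof -
  obtain N where N: "{x \<in> space lborel. \<not> P x} \<subseteq> N" "emeasure lborel N = 0" "N \<in> sets lborel"
    using AE_E[OF assms] by blast
  then show ?thesis
    by (intro outer_measure_leI[of _ N]) (auto simp: fmeasurable_def measure_def)
qed

section \<open>The covering argument for maximal functions\<close>

text \<open>
Vitali's lemma selects disjoint intervals whose fivefold enlargements cover the set, and each selected
interval is shorter than a multiple of its \<open>\<nu>\<close>-value. Only the bound for finite disjoint families enters, so
\<open>\<nu>\<close> can be a sum of point masses as well as Lebesgue measure restricted to a set.
\<close>

lemma maximal_weak_type:
  fixes \<nu> :: "real set \<Rightarrow> real"
  assumes "0 < \<alpha>"
    and disj: "\<And>C r. finite C \<Longrightarrow> (\<And>x. x \<in> C \<Longrightarrow> 0 < r x) \<Longrightarrow>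
      disjoint_family_on (\<lambda>x. cball x (r x)) C \<Longrightarrow> (\<Sum>x\<in>C. \<nu> (cball x (r x))) \<le> M"
  shows "outer_measure_le {x. \<exists>r>0. \<alpha> * r < \<nu> (cball x r)} (10 * M / \<alpha>)"
proof -
  define K where "K = {x. \<exists>r>0. \<alpha> * r < \<nu> (cball x r)}"
  have "\<forall>x\<in>K. \<exists>r. 0 < r \<and> \<alpha> * r < \<nu> (cball x r)"
    by (auto simp: K_def)
  from bchoice[OF this] obtain r
    where r: "\<And>x. x \<in> K \<Longrightarrow> 0 < r x \<and> \<alpha> * r x < \<nu> (cball x (r x))"
    by blast
  have rad: "0 < r x \<and> r x \<le> M / \<alpha>" if "x \<in> K" for x
  proof -
    have "\<nu> (cball x (r x)) \<le> M"
      using disj[of "{x}" r] r[OF that] by (simp add: disjoint_family_on_def)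
    then show ?thesis
      using r[OF that] \<open>0 < \<alpha>\<close> by (simp add: pos_le_divide_eq mult.commute)
  qed
  have cov: "K \<subseteq> (\<Union>x\<in>K. cball x (r x))"
    using r by (auto simp: less_imp_le)
  obtain C where C: "countable C" "C \<subseteq> K"
     "pairwise (\<lambda>i j. disjnt (cball i (r i)) (cball j (r j))) C"
     "K \<subseteq> (\<Union>i\<in>C. cball i (5 * r i))"
    using Vitali_covering_lemma_cballs[where a = "\<lambda>x. x", OF cov rad] by blast
  have fin: "measure lborel (\<Union>i\<in>I. cball i (5 * r i)) \<le> 10 * M / \<alpha>" if "I \<subseteq> C" "finite I" for I
  proof -
    have rI: "0 < r x" "\<alpha> * r x < \<nu> (cball x (r x))" if "x \<in> I" for x
      using r that \<open>I \<subseteq> C\<close> C(2) by blast+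
    have "disjoint_family_on (\<lambda>x. cball x (r x)) I"
      using C(3) that unfolding pairwise_def disjoint_family_on_def disjnt_def by blast
    then have M: "(\<Sum>x\<in>I. \<nu> (cball x (r x))) \<le> M"
      using disj that rI by blast
    have "measure lborel (\<Union>i\<in>I. cball i (5 * r i)) \<le> (\<Sum>i\<in>I. measure lborel (cball i (5 * r i)))"
      using that by (intro measure_UNION_le) auto
    also have "\<dots> = (\<Sum>i\<in>I. 10 * r i)"
      using rI by (intro sum.cong) (auto simp: cball_eq_atLeastAtMost less_imp_le)
    also have "\<dots> \<le> (\<Sum>i\<in>I. 10 / \<alpha> * \<nu> (cball i (r i)))"
      using rI \<open>0 < \<alpha>\<close> by (intro sum_mono) (simp add: field_simps less_imp_le)
    also have "\<dots> = 10 / \<alpha> * (\<Sum>i\<in>I. \<nu> (cball i (r i)))"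
      by (simp add: sum_distrib_left)
    also have "\<dots> \<le> 10 / \<alpha> * M"
      using M \<open>0 < \<alpha>\<close> by (intro mult_left_mono) auto
    finally show ?thesis by simp
  qed
  have "cball i (5 * r i) \<in> fmeasurable lborel" for i
    by (intro fmeasurable_compact compact_cball)
  then show ?thesis
    using C(4) fin unfolding K_def[symmetric]
    by (intro outer_measure_leI[OF C(4)] fmeasurable_UN_bound[OF C(1)] measure_UN_bound[OF C(1)])
qed

section \<open>Boole's estimate for finite sums of poles\<close>

text \<open>
For \<open>w \<ge> 0\<close> this is the Hilbert transform of the measure with mass \<open>w s\<close> at \<open>s\<close>, except that at a point
of \<open>S\<close> the singular term counts as \<open>0\<close>.
\<close>

definition pole_sum :: "real set \<Rightarrow> (real \<Rightarrow> real) \<Rightarrow> real \<Rightarrow> real" where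
  "pole_sum S w x = (\<Sum>s\<in>S. w s / (s - x))"

lemma pole_sum_borel [measurable]: "pole_sum S w \<in> borel_measurable borel"
  unfolding pole_sum_def[abs_def] by measurable

lemma pole_sum_remove:
  assumes "finite S" "s \<in> S"
  shows "pole_sum S w = (\<lambda>x. w s / (s - x) + pole_sum (S - {s}) w x)"
  using assms by (simp add: pole_sum_def sum.remove fun_eq_iff)

lemma pole_sum_union:
  "finite S \<Longrightarrow> finite T \<Longrightarrow> S \<inter> T = {} \<Longrightarrow> pole_sum (S \<union> T) w x = pole_sum S w x + pole_sum T w x"
  unfolding pole_sum_def by (rule sum.union_disjoint)

lemma isCont_pole_sum: "finite S \<Longrightarrow> x \<notin> S \<Longrightarrow> isCont (pole_sum S w) x"
  unfolding pole_sum_def[abs_def] by (intro continuous_intros) auto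

lemma pole_sum_at_left:
  assumes "finite S" "s \<in> S" "w s > 0"
  shows "LIM x at_left s. pole_sum S w x :> at_top"
proof -
  have "(pole_sum (S - {s}) w \<longlongrightarrow> pole_sum (S - {s}) w s) (at_left s)"
    using isCont_pole_sum[of "S - {s}" s w] assms
    by (simp add: isCont_def filterlim_at_split)
  moreover have "LIM x at_left s. w s / (s - x) :> at_top"
    using assms(3) by real_asymp
  ultimately show ?thesis
    unfolding pole_sum_remove[OF assms(1,2), of w]
    by (subst add.commute) (rule filterlim_tendsto_add_at_top)
qed

lemma pole_sum_at_right:
  assumes "finite S" "s \<in> S" "w s > 0"
  shows "LIM x at_right s. pole_sum S w x :> at_bot"
proof -
  have "(pole_sum (S - {s}) w \<longlongrightarrow> pole_sum (S - {s}) w s) (at_right s)"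
    using isCont_pole_sum[of "S - {s}" s w] assms
    by (simp add: isCont_def filterlim_at_split)
  then have "((\<lambda>x. - pole_sum (S - {s}) w x) \<longlongrightarrow> - pole_sum (S - {s}) w s) (at_right s)"
    by (rule tendsto_minus)
  moreover have "LIM x at_right s. - (w s / (s - x)) :> at_top"
    using assms(3) by real_asymp
  ultimately have "LIM x at_right s. - pole_sum (S - {s}) w x + - (w s / (s - x)) :> at_top"
    by (rule filterlim_tendsto_add_at_top)
  then show ?thesis
    unfolding pole_sum_remove[OF assms(1,2), of w] filterlim_uminus_at_bot
    by (simp only: minus_add_distrib add.commute)
qed

lemma pole_sum_at_minus_infinity: "(pole_sum S w \<longlongrightarrow> 0) at_bot"
proof -
  have "((\<lambda>x. w s / (s - x)) \<longlongrightarrow> 0) at_bot" for s by real_asymp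
  then have "((\<lambda>x. \<Sum>s\<in>S. w s / (s - x)) \<longlongrightarrow> (\<Sum>s\<in>S. 0)) at_bot"
    by (intro tendsto_sum)
  then show ?thesis by (simp add: pole_sum_def[abs_def])
qed

text \<open>
Between two neighbouring poles the sum increases from \<open>-\<infinity>\<close> to \<open>\<infinity>\<close>, and to the left of the first
pole it starts from \<open>0\<close>; so each pole has a root of the equation \<open>pole_sum S w r = t\<close> in the gap to its
left.
\<close>

lemma pole_sum_root:
  assumes "finite S" "s \<in> S" "\<And>s. s \<in> S \<Longrightarrow> 0 < w s" "0 < t"
  shows "\<exists>r<s. (\<forall>s'\<in>S. s' < s \<longrightarrow> s' < r) \<and> pole_sum S w r = t"
proof -
  obtain u where u: "u < s" "\<forall>s'\<in>S. s' < s \<longrightarrow> s' < u" "pole_sum S w u < t"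
  proof (cases "\<exists>s'\<in>S. s' < s")
    case False
    have "eventually (\<lambda>x. pole_sum S w x < t) at_bot"
      using pole_sum_at_minus_infinity order_tendstoD(2) \<open>0 < t\<close> by blast
    then have "eventually (\<lambda>x. pole_sum S w x < t \<and> x < s) at_bot"
      using eventually_gt_at_bot by (intro eventually_conj) auto
    then obtain u where "pole_sum S w u < t" "u < s"
      using eventually_happens'[OF trivial_limit_at_bot_linorder] by blast
    then show ?thesis using that False by blast
  next
    case True
    define p where "p = Max {s'\<in>S. s' < s}"
    have p: "p \<in> S" "p < s" "\<And>s'. s' \<in> S \<Longrightarrow> s' < s \<Longrightarrow> s' \<le> p"
    proof -
      have "p \<in> {s'\<in>S. s' < s}"
        unfolding p_def using True \<open>finite S\<close> by (intro Max_in) auto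
      then show "p \<in> S" "p < s" by auto
      show "s' \<le> p" if "s' \<in> S" "s' < s" for s'
        unfolding p_def using that \<open>finite S\<close> by (intro Max_ge) auto
    qed
    have "eventually (\<lambda>x. pole_sum S w x < t) (at_right p)"
      using pole_sum_at_right[of S p w] p(1) assms
      by (simp add: filterlim_at_bot_dense)
    then have "eventually (\<lambda>x. pole_sum S w x < t \<and> x \<in> {p<..<s}) (at_right p)"
      using eventually_at_right_real[OF p(2)] by (intro eventually_conj)
    then obtain u where "pole_sum S w u < t" "u \<in> {p<..<s}"
      using eventually_happens'[OF trivial_limit_at_right_real] by blast
    then show ?thesis using that p by fastforce
  qed
  have "eventually (\<lambda>x. pole_sum S w x > t) (at_left s)"
    using pole_sum_at_left[of S s w] assms
    by (simp add: filterlim_at_top_dense)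
  then have "eventually (\<lambda>x. pole_sum S w x > t \<and> x \<in> {u<..<s}) (at_left s)"
    using eventually_at_left_real[OF u(1)] by (intro eventually_conj)
  then obtain v where v: "pole_sum S w v > t" "v \<in> {u<..<s}"
    using eventually_happens'[OF trivial_limit_at_left_real] by blast
  have "x \<notin> S" if "u \<le> x" "x \<le> v" for x
    using u v that by (metis greaterThanLessThan_iff le_less_trans not_le)
  then have "\<exists>x\<ge>u. x \<le> v \<and> pole_sum S w x = t"
    using u v isCont_pole_sum[OF \<open>finite S\<close>] by (intro IVT) auto
  then show ?thesis
    using u v by (metis greaterThanLessThan_iff le_less_trans less_le_trans)
qed

text \<open>
Multiplying \<open>t - pole_sum S w x\<close> by the product of all \<open>x - s\<close> gives a polynomial with leading coefficient
\<open>t\<close> and degree the number of poles, so its known roots are all of its roots.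
\<close>

lemma pole_sum_superlevel_product:
  assumes "finite S" "\<And>s. s \<in> S \<Longrightarrow> 0 < w s" "0 < t"
    and r: "\<And>s. s \<in> S \<Longrightarrow> pole_sum S w (r s) = t" "inj_on r S" "r ` S \<inter> S = {}"
    and x: "x \<notin> S"
  shows "t - pole_sum S w x = t * (\<Prod>s\<in>S. (x - r s) / (x - s))"
proof -
  define p where "p = smult t (\<Prod>s\<in>S. [:-s, 1:]) + (\<Sum>s\<in>S. smult (w s) (\<Prod>u\<in>S-{s}. [:-u, 1:]))"
  define q where "q = smult t (\<Prod>s\<in>S. [:-r s, 1:])"
  have poly_p: "poly p y = (\<Prod>s\<in>S. y - s) * (t - pole_sum S w y)" if "y \<notin> S" for y
  proof -
    have "w s * (\<Prod>u\<in>S-{s}. y - u) = - (\<Prod>s\<in>S. y - s) * (w s / (s - y))" if "s \<in> S" for s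
    proof -
      have "(\<Prod>s\<in>S. y - s) = (y - s) * (\<Prod>u\<in>S-{s}. y - u)"
        using that \<open>finite S\<close> by (simp add: prod.remove)
      moreover have "y - s = - (s - y)" "s - y \<noteq> 0"
        using that \<open>y \<notin> S\<close> by auto
      ultimately show ?thesis by (simp del: minus_diff_eq)
    qed
    then have "poly p y = t * (\<Prod>s\<in>S. y - s) + (\<Sum>s\<in>S. - (\<Prod>s\<in>S. y - s) * (w s / (s - y)))"
      by (simp add: p_def poly_sum poly_prod)
    then show ?thesis
      unfolding pole_sum_def by (simp add: sum_distrib_left sum_negf algebra_simps)
  qed
  have deg: "degree (\<Prod>s\<in>A. [:-f s, 1:]) = card A" for A :: "real set" and f :: "real \<Rightarrow> real"
    by (simp add: degree_prod_sum_eq)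
  have lead: "coeff (\<Prod>s\<in>A. [:-f s, 1:]) (card A) = 1" for A :: "real set" and f :: "real \<Rightarrow> real"
    using lead_coeff_prod[of "\<lambda>s. [:-f s, 1:]" A] by (simp add: deg)
  have low: "coeff (\<Prod>u\<in>S-{s}. [:-u, 1:]) (card S) = 0" if "s \<in> S" for s
    using deg[of "\<lambda>u. u" "S - {s}"] card_Diff1_less[OF \<open>finite S\<close> that]
    by (intro coeff_eq_0) simp
  have "p = q"
  proof (rule poly_eqI_degree_lead_coeff[of _ "card S" _ "r ` S"])
    show "coeff p (card S) = coeff q (card S)"
      using lead[of "\<lambda>u. u" S] lead[of r S] by (simp add: p_def q_def coeff_sum low)
    show "card S \<le> card (r ` S)"
      using r(2) by (simp add: card_image)
    show "degree p \<le> card S"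
      unfolding p_def using deg[of "\<lambda>u. u"] \<open>finite S\<close>
      by (intro degree_add_le degree_sum_le order.trans[OF degree_smult_le])
         (auto simp: card_mono)
    show "degree q \<le> card S"
      unfolding q_def using deg[of r S] order.trans[OF degree_smult_le] by fastforce
    show "poly p z = poly q z" if "z \<in> r ` S" for z
    proof -
      have "z \<notin> S" using that r(3) by blast
      then have "poly p z = 0" using that r(1) by (auto simp: poly_p)
      moreover have "poly q z = 0"
        using that \<open>finite S\<close> by (auto simp: q_def poly_prod intro!: prod_zero)
      ultimately show ?thesis by simp
    qed
  qed
  then have "(\<Prod>s\<in>S. x - s) * (t - pole_sum S w x) = t * (\<Prod>s\<in>S. x - r s)"
    using poly_p[OF x] by (simp add: q_def poly_prod)
  moreover have "(\<Prod>s\<in>S. x - s) \<noteq> 0" using x \<open>finite S\<close> by auto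
  ultimately show ?thesis
    by (simp add: prod_dividef field_simps)
qed

lemma one_plus_sum_le_prod:
  fixes f :: "'a \<Rightarrow> real"
  assumes "\<And>x. x \<in> A \<Longrightarrow> 0 \<le> f x"
  shows "1 + (\<Sum>x\<in>A. f x) \<le> (\<Prod>x\<in>A. 1 + f x)"
  using assms
proof (induction A rule: infinite_finite_induct)
  case (insert a A)
  have "1 + sum f (insert a A) \<le> (1 + f a) * (1 + sum f A)"
    using insert sum_nonneg[of A f] by (simp add: algebra_simps)
  also have "\<dots> \<le> (1 + f a) * (\<Prod>x\<in>A. 1 + f x)"
    using insert by (intro mult_left_mono) auto
  finally show ?case using insert by simp
qed auto

text \<open>
The product formula shows that \<open>t - pole_sum S w x\<close> is negative only between a root and its pole. The
total length of these intervals is the first-order coefficient of the product at infinity, and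
\<open>sum w S / t\<close> is that of \<open>1 - pole_sum S w x / t\<close>.
\<close>

lemma boole_pos:
  assumes "finite S" "\<And>s. s \<in> S \<Longrightarrow> 0 < w s" "0 < t"
  shows "outer_measure_le {x. t < pole_sum S w x} (sum w S / t)"
proof -
  obtain r where r: "\<And>s. s \<in> S \<Longrightarrow> r s < s \<and> (\<forall>s'\<in>S. s' < s \<longrightarrow> s' < r s) \<and> pole_sum S w (r s) = t"
    using bchoice[of S "\<lambda>s r. r < s \<and> (\<forall>s'\<in>S. s' < s \<longrightarrow> s' < r) \<and> pole_sum S w r = t"]
      pole_sum_root[of S _ w t] assms by blast
  have "r s < r s'" if "s \<in> S" "s' \<in> S" "s < s'" for s s'
    using r[OF that(1)] r[OF that(2)] that by (meson order_less_trans)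
  then have "inj_on r S"
    by (metis inj_onI less_irrefl linorder_neqE_linordered_idom)
  moreover have "r ` S \<inter> S = {}"
    using r by (smt (verit, best) disjoint_iff imageE)
  ultimately have prod: "t - pole_sum S w x = t * (\<Prod>s\<in>S. (x - r s) / (x - s))" if "x \<notin> S" for x
    using that assms r by (intro pole_sum_superlevel_product) auto
  have "{x. t < pole_sum S w x} \<subseteq> (\<Union>s\<in>S. {r s..s})"
  proof
    fix x assume x: "x \<in> {x. t < pole_sum S w x}"
    show "x \<in> (\<Union>s\<in>S. {r s..s})"
    proof (rule ccontr)
      assume n: "x \<notin> (\<Union>s\<in>S. {r s..s})"
      then have "x \<notin> S" using r by (force simp: less_imp_le)
      have "0 \<le> (\<Prod>s\<in>S. (x - r s) / (x - s))"
      proof (intro prod_nonneg)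
        fix s assume "s \<in> S"
        then have "x < r s \<or> s < x" "r s < s" using n r by auto
        then show "0 \<le> (x - r s) / (x - s)" by (auto simp: zero_le_divide_iff)
      qed
      then show False
        using prod[OF \<open>x \<notin> S\<close>] x \<open>0 < t\<close> by (smt (verit) mem_Collect_eq mult_nonneg_nonneg)
    qed
  qed
  moreover have "measure lborel (\<Union>s\<in>S. {r s..s}) \<le> sum w S / t"
  proof -
    have "measure lborel (\<Union>s\<in>S. {r s..s}) \<le> (\<Sum>s\<in>S. measure lborel {r s..s})"
      using \<open>finite S\<close> by (intro measure_UNION_le) auto
    also have "\<dots> = (\<Sum>s\<in>S. s - r s)"
      using r by (intro sum.cong) (auto simp: less_imp_le)
    also have "\<dots> \<le> sum w S / t"
    proof -
      \<comment> \<open>first-order terms of the product formula for large \<open>x\<close>, multiplied by \<open>x\<close>\<close>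
      have ev: "eventually (\<lambda>x. (\<Sum>s\<in>S. (s - r s) * (x / (x - s))) \<le> (\<Sum>s\<in>S. w s / t * (x / (x - s)))) at_top"
      proof -
        have "eventually (\<lambda>x. \<forall>s\<in>S. s < x) at_top"
          using \<open>finite S\<close> eventually_gt_at_top by (intro eventually_ball_finite) auto
        then show ?thesis
          using eventually_gt_at_top[of 0]
        proof eventually_elim
          case (elim x)
          then have xS: "x \<notin> S" by auto
          have "1 + (\<Sum>s\<in>S. (s - r s) / (x - s)) \<le> (\<Prod>s\<in>S. 1 + (s - r s) / (x - s))"
            using elim r by (intro one_plus_sum_le_prod) (auto simp: less_imp_le)
          also have "\<dots> = (\<Prod>s\<in>S. (x - r s) / (x - s))"
            using elim by (intro prod.cong) (auto simp: field_simps)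
          also have "\<dots> = 1 - pole_sum S w x / t"
            using prod[OF xS] \<open>0 < t\<close> by (simp add: field_simps)
          also have "\<dots> = 1 + (\<Sum>s\<in>S. (w s / t) / (x - s))"
          proof -
            have "- pole_sum S w x / t = (\<Sum>s\<in>S. (w s / t) / (x - s))"
              unfolding pole_sum_def sum_divide_distrib sum_negf[symmetric] 
              using elim \<open>0 < t\<close> by (intro sum.cong) (auto simp: divide_simps algebra_simps)
            then show ?thesis by simp
          qed
          finally have "x * (\<Sum>s\<in>S. (s - r s) / (x - s)) \<le> x * (\<Sum>s\<in>S. (w s / t) / (x - s))"
            using elim by (intro mult_left_mono) auto
          then show ?case by (simp add: sum_distrib_left mult.commute)
        qed
      qed
      have lim: "((\<lambda>x. \<Sum>s\<in>S. c s * (x / (x - s))) \<longlongrightarrow> (\<Sum>s\<in>S. c s * 1)) at_top" for c :: "real \<Rightarrow> real"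
      proof (intro tendsto_sum tendsto_mult tendsto_const)
        show "((\<lambda>x. x / (x - s)) \<longlongrightarrow> 1) at_top" for s :: real by real_asymp
      qed
      have "(\<Sum>s\<in>S. (s - r s) * 1) \<le> (\<Sum>s\<in>S. w s / t * 1)"
        by (rule tendsto_le[OF _ lim lim ev]) simp
      then show ?thesis by (simp add: sum_divide_distrib)
    qed
    finally show ?thesis .
  qed
  ultimately show ?thesis
    using \<open>finite S\<close>
    by (intro outer_measure_leI[of _ "\<Union>s\<in>S. {r s..s}"]) (auto intro!: fmeasurable.finite_UN fmeasurable_compact)
qed

text \<open>
Reflection in the origin turns the negative superlevel set into a positive one.
\<close>

lemma boole:
  assumes "finite S" "\<And>s. s \<in> S \<Longrightarrow> 0 \<le> w s" "0 < t"
  shows "outer_measure_le {x. t < \<bar>pole_sum S w x\<bar>} (2 * sum w S / t)"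
proof -
  define T where "T = {s\<in>S. 0 < w s}"
  have T: "finite T" "\<And>s. s \<in> T \<Longrightarrow> 0 < w s" using \<open>finite S\<close> by (auto simp: T_def)
  have zero: "w s = 0" if "s \<in> S - T" for s
    using that assms(2)[of s] by (auto simp: T_def)
  have "sum w S = sum w T"
    using zero assms(1) by (intro sum.mono_neutral_right) (auto simp: T_def)
  moreover have "pole_sum S w x = pole_sum T w x" for x
    unfolding pole_sum_def using zero assms(1)
    by (intro sum.mono_neutral_right) (auto simp: T_def)
  moreover have "outer_measure_le {x. t < \<bar>pole_sum T w x\<bar>} (sum w T / t + sum w T / t)"
  proof -
    have refl: "pole_sum (uminus ` T) (\<lambda>s. w (- s)) (- x) = - pole_sum T w x" for x
      unfolding pole_sum_def sum_negf[symmetric]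
      by (subst sum.reindex) (auto intro!: sum.cong simp: divide_simps algebra_simps)
    have "sum (\<lambda>s. w (- s)) (uminus ` T) = sum w T"
      by (subst sum.reindex) auto
    then have "outer_measure_le {x. t < pole_sum (uminus ` T) (\<lambda>s. w (- s)) x} (sum w T / t)"
      using boole_pos[of "uminus ` T" "\<lambda>s. w (- s)" t] T \<open>0 < t\<close> by force
    from outer_measure_le_Un[OF boole_pos[OF T \<open>0 < t\<close>] outer_measure_le_uminus[OF this]]
    show ?thesis
      by (rule outer_measure_le_mono) (auto simp: refl)
  qed
  ultimately show ?thesis by simp
qed

section \<open>Maximal truncations of finite sums of poles\<close>

text \<open>
A dyadic summation, carried out as an induction that doubles \<open>\<epsilon>\<close>: the poles at distance between \<open>\<epsilon>\<close> and
\<open>2 \<epsilon>\<close> contribute at most \<open>2 \<alpha> / \<epsilon>\<close>, which is half of the claimed bound, and the bound for the rest is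
the other half.
\<close>

lemma inverse_square_tail:
  fixes S :: "real set"
  assumes "finite S" "\<And>s. s \<in> S \<Longrightarrow> 0 \<le> w s"
    and growth: "\<And>r. 0 < r \<Longrightarrow> sum w (S \<inter> cball x r) \<le> \<alpha> * r" and "0 < \<epsilon>"
  shows "(\<Sum>s\<in>{s\<in>S. \<epsilon> < \<bar>s - x\<bar>}. w s / (s - x)\<^sup>2) \<le> 4 * \<alpha> / \<epsilon>"
proof -
  have "0 \<le> sum w (S \<inter> cball x 1)" using assms(2) by (intro sum_nonneg) auto
  then have "0 \<le> \<alpha>" using growth[of 1] by simp
  have main: "(\<Sum>s\<in>{s\<in>S. \<epsilon> < \<bar>s - x\<bar>}. w s / (s - x)\<^sup>2) \<le> 4 * \<alpha> / \<epsilon>"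
    if "0 < \<epsilon>" "\<forall>s\<in>S. \<bar>s - x\<bar> \<le> 2 ^ n * \<epsilon>" for n \<epsilon>
    using that
  proof (induction n arbitrary: \<epsilon>)
    case 0
    then have none: "{s\<in>S. \<epsilon> < \<bar>s - x\<bar>} = {}" by force
    show ?case unfolding none using 0 \<open>0 \<le> \<alpha>\<close> by simp
  next
    case (Suc n)
    let ?g = "\<lambda>s. w s / (s - x)\<^sup>2"
    have "(\<Sum>s\<in>{s\<in>S. \<epsilon> < \<bar>s - x\<bar>}. ?g s)
        = (\<Sum>s\<in>{s\<in>S. \<epsilon> < \<bar>s - x\<bar> \<and> \<bar>s - x\<bar> \<le> 2 * \<epsilon>} \<union> {s\<in>S. 2 * \<epsilon> < \<bar>s - x\<bar>}. ?g s)"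
      using Suc.prems by (intro sum.cong) auto
    also have "\<dots> = (\<Sum>s\<in>{s\<in>S. \<epsilon> < \<bar>s - x\<bar> \<and> \<bar>s - x\<bar> \<le> 2 * \<epsilon>}. ?g s)
        + (\<Sum>s\<in>{s\<in>S. 2 * \<epsilon> < \<bar>s - x\<bar>}. ?g s)"
      using \<open>finite S\<close> by (intro sum.union_disjoint) auto
    also have "(\<Sum>s\<in>{s\<in>S. 2 * \<epsilon> < \<bar>s - x\<bar>}. ?g s) \<le> 4 * \<alpha> / (2 * \<epsilon>)"
      using Suc.prems by (intro Suc.IH) (auto simp: mult_ac)
    also have "(\<Sum>s\<in>{s\<in>S. \<epsilon> < \<bar>s - x\<bar> \<and> \<bar>s - x\<bar> \<le> 2 * \<epsilon>}. ?g s)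
        \<le> (\<Sum>s\<in>{s\<in>S. \<epsilon> < \<bar>s - x\<bar> \<and> \<bar>s - x\<bar> \<le> 2 * \<epsilon>}. w s / \<epsilon>\<^sup>2)"
    proof (intro sum_mono)
      fix s assume s: "s \<in> {s\<in>S. \<epsilon> < \<bar>s - x\<bar> \<and> \<bar>s - x\<bar> \<le> 2 * \<epsilon>}"
      then have "\<epsilon>\<^sup>2 \<le> (s - x)\<^sup>2" using Suc.prems(1) by (simp add: power2_le_iff_abs_le less_imp_le abs_le_square_iff[symmetric])
      then show "?g s \<le> w s / \<epsilon>\<^sup>2"
        using s assms(2)[of s] Suc.prems(1) by (intro divide_left_mono) (auto intro!: mult_pos_pos)
    qed
    also have "\<dots> \<le> sum w (S \<inter> cball x (2 * \<epsilon>)) / \<epsilon>\<^sup>2"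
      unfolding sum_divide_distrib using assms(1,2) Suc.prems(1)
      by (intro sum_mono2) (auto simp: dist_real_def)
    also have "\<dots> \<le> \<alpha> * (2 * \<epsilon>) / \<epsilon>\<^sup>2"
      using growth[of "2 * \<epsilon>"] Suc.prems(1) by (intro divide_right_mono) auto
    also have "\<alpha> * (2 * \<epsilon>) / \<epsilon>\<^sup>2 + 4 * \<alpha> / (2 * \<epsilon>) = 4 * \<alpha> / \<epsilon>"
      using Suc.prems(1) by (simp add: power2_eq_square field_simps)
    finally show ?case by simp
  qed
  define M where "M = (\<Sum>s\<in>S. \<bar>s - x\<bar>)"
  have M: "\<forall>s\<in>S. \<bar>s - x\<bar> \<le> M"
    unfolding M_def using \<open>finite S\<close> by (auto intro!: member_le_sum)
  obtain n where "M / \<epsilon> < 2 ^ n"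
    using real_arch_pow[of 2 "M / \<epsilon>"] by auto
  then have "M \<le> 2 ^ n * \<epsilon>" using \<open>0 < \<epsilon>\<close> by (simp add: pos_divide_less_eq)
  then show ?thesis using M \<open>0 < \<epsilon>\<close> by (intro main[of \<epsilon> n]) force+
qed

text \<open>
The kernel has derivative of size \<open>1 / \<bar>s - x\<bar>\<^sup>2\<close>, so the oscillation over an interval of length
comparable to \<open>\<epsilon>\<close> is controlled by the tail of the inverse squares.
\<close>

lemma far_poles_almost_constant:
  assumes "finite S" "\<And>s. s \<in> S \<Longrightarrow> 0 \<le> w s"
    and growth: "\<And>r. 0 < r \<Longrightarrow> sum w (S \<inter> cball x r) \<le> \<alpha> * r" and "0 < \<epsilon>"
    and y: "\<bar>y - x\<bar> \<le> \<epsilon> / 2"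
  shows "\<bar>pole_sum {s\<in>S. \<epsilon> < \<bar>s - x\<bar>} w y - pole_sum {s\<in>S. \<epsilon> < \<bar>s - x\<bar>} w x\<bar> \<le> 4 * \<alpha>"
proof -
  let ?F = "{s\<in>S. \<epsilon> < \<bar>s - x\<bar>}"
  have "\<bar>pole_sum ?F w y - pole_sum ?F w x\<bar> \<le> (\<Sum>s\<in>?F. \<bar>w s / (s - y) - w s / (s - x)\<bar>)"
    unfolding pole_sum_def sum_subtractf[symmetric] by (rule sum_abs)
  also have "\<dots> \<le> (\<Sum>s\<in>?F. \<epsilon> * (w s / (s - x)\<^sup>2))"
  proof (intro sum_mono)
    fix s assume s: "s \<in> ?F"
    have near: "\<bar>s - x\<bar> / 2 \<le> \<bar>s - y\<bar>" using s y by (simp add: abs_if split: if_splits)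
    then have nz: "s \<noteq> y" "s \<noteq> x" using s \<open>0 < \<epsilon>\<close> by auto
    have "\<bar>w s / (s - y) - w s / (s - x)\<bar> = w s * \<bar>y - x\<bar> / (\<bar>s - y\<bar> * \<bar>s - x\<bar>)"
    proof -
      have "w s / (s - y) - w s / (s - x) = w s * (y - x) / ((s - y) * (s - x))"
        using nz by (simp add: divide_simps algebra_simps)
      then show ?thesis using s assms(2)[of s] by (simp add: abs_mult)
    qed
    also have "\<dots> \<le> w s * (\<epsilon> / 2) / ((\<bar>s - x\<bar> / 2) * \<bar>s - x\<bar>)"
      using s assms(2)[of s] near y nz \<open>0 < \<epsilon>\<close>
      by (intro frac_le mult_left_mono mult_right_mono mult_pos_pos) auto
    also have "\<dots> = \<epsilon> * (w s / (s - x)\<^sup>2)"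
      by (simp add: power2_eq_square mult_ac)
    finally show "\<bar>w s / (s - y) - w s / (s - x)\<bar> \<le> \<epsilon> * (w s / (s - x)\<^sup>2)" .
  qed
  also have "\<dots> \<le> \<epsilon> * (4 * \<alpha> / \<epsilon>)"
    unfolding sum_distrib_left[symmetric]
    using inverse_square_tail[OF assms(1-4)] \<open>0 < \<epsilon>\<close> by (intro mult_left_mono) auto
  finally show ?thesis using \<open>0 < \<epsilon>\<close> by simp
qed

text \<open>
Near \<open>x\<close> the far poles contribute almost the same as at \<open>x\<close>, hence more than \<open>3 t / 4\<close> in modulus. The
full sum can then be as small as \<open>t / 2\<close> only where the near poles contribute more than \<open>t / 4\<close>, and
Boole's estimate with the small mass of the near poles makes that happen on at most half of the interval.
\<close>

lemma cotlar_density: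
  assumes "finite S" "\<And>s. s \<in> S \<Longrightarrow> 0 \<le> w s" "0 < t" "0 < \<epsilon>"
    and growth: "\<And>r. 0 < r \<Longrightarrow> sum w (S \<inter> cball x r) \<le> t / 16 * r"
    and large: "t < \<bar>pole_sum {s\<in>S. \<epsilon> < \<bar>s - x\<bar>} w x\<bar>"
  shows "\<epsilon> / 2 \<le> measure lborel ({y. t / 2 < \<bar>pole_sum S w y\<bar>} \<inter> cball x (\<epsilon> / 2))"
proof -
  define F N where "F = {s\<in>S. \<epsilon> < \<bar>s - x\<bar>}" and "N = {s\<in>S. \<bar>s - x\<bar> \<le> \<epsilon>}"
  define E I where "E = {y. t / 2 < \<bar>pole_sum S w y\<bar>}" and "I = cball x (\<epsilon> / 2)"
  have S: "S = F \<union> N" and "finite F" "finite N" "F \<inter> N = {}"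
    using \<open>finite S\<close> by (auto simp: F_def N_def)
  then have split: "pole_sum S w y = pole_sum F w y + pole_sum N w y" for y
    using pole_sum_union[of F N w y] by metis
  have meas: "E \<in> sets borel" "I \<in> fmeasurable lborel"
    unfolding E_def I_def by (measurable, intro fmeasurable_compact compact_cball)
  have "I - E \<subseteq> {y. t / 4 < \<bar>pole_sum N w y\<bar>}"
  proof
    fix y assume y: "y \<in> I - E"
    then have "\<bar>pole_sum F w y - pole_sum F w x\<bar> \<le> 4 * (t / 16)"
      unfolding F_def using assms growth
      by (intro far_poles_almost_constant) (auto simp: I_def dist_real_def abs_minus_commute)
    then have "\<bar>pole_sum F w y\<bar> > 3 * t / 4"
      using large unfolding F_def[symmetric] by (simp add: abs_if split: if_splits)
    moreover have "\<bar>pole_sum S w y\<bar> \<le> t / 2" using y by (auto simp: E_def)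
    ultimately show "y \<in> {y. t / 4 < \<bar>pole_sum N w y\<bar>}"
      using split[of y] by (simp add: abs_if split: if_splits)
  qed
  moreover have "outer_measure_le {y. t / 4 < \<bar>pole_sum N w y\<bar>} (2 * sum w N / (t / 4))"
    using assms by (intro boole) (auto simp: N_def)
  ultimately have "outer_measure_le (I - E) (2 * sum w N / (t / 4))"
    using outer_measure_le_mono by blast
  then have "measure lborel (I - E) \<le> 2 * sum w N / (t / 4)"
    using meas by (intro outer_measure_le_measurable) auto
  also have "N = S \<inter> cball x \<epsilon>" by (auto simp: N_def dist_real_def)
  also have "2 * sum w (S \<inter> cball x \<epsilon>) / (t / 4) \<le> 2 * (t / 16 * \<epsilon>) / (t / 4)"
    using growth[OF \<open>0 < \<epsilon>\<close>] \<open>0 < t\<close> by (intro divide_right_mono mult_left_mono) auto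
  also have "\<dots> = \<epsilon> / 2" using \<open>0 < t\<close> by simp
  finally have 1: "measure lborel (I - E) \<le> \<epsilon> / 2" .
  have "measure lborel I = \<epsilon>"
    using \<open>0 < \<epsilon>\<close> by (simp add: I_def cball_eq_atLeastAtMost)
  moreover have "measure lborel I = measure lborel (E \<inter> I) + measure lborel (I - E)"
  proof -
    have "E \<inter> I \<in> fmeasurable lborel"
      using meas(1) fmeasurableD[OF meas(2)] by (intro fmeasurableI2[OF meas(2)]) auto
    moreover have "E \<inter> I \<union> I = I" "I - E \<inter> I = I - E" by blast+
    ultimately show ?thesis using measure_Un2[of "E \<inter> I" lborel I] meas(2) by metis
  qed
  ultimately show ?thesis using 1 by (simp add: E_def I_def)
qed

lemma discrete_maximal_weak_type:
  assumes "finite S" "\<And>s. s \<in> S \<Longrightarrow> 0 \<le> w s" "0 < t"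
  shows "outer_measure_le {x. \<exists>\<epsilon>>0. t < \<bar>pole_sum {s\<in>S. \<epsilon> < \<bar>s - x\<bar>} w x\<bar>} (240 * sum w S / t)"
proof -
  define E where "E = {y. t / 2 < \<bar>pole_sum S w y\<bar>}"
  have "outer_measure_le E (2 * sum w S / (t / 2))"
    unfolding E_def using assms by (intro boole) auto
  moreover have "E \<in> sets borel" unfolding E_def by measurable
  ultimately have E: "E \<in> fmeasurable lborel" "measure lborel E \<le> 4 * sum w S / t"
    using outer_measure_le_measurable[of E "4 * sum w S / t"] by auto
  \<comment> \<open>points around which mass concentrates, and points of positive density of the large values of the full sum\<close>
  define A1 where "A1 = {x. \<exists>r>0. t / 16 * r < sum w (S \<inter> cball x r)}"
  define A2 where "A2 = {x. \<exists>r>0. 1 / 2 * r < measure lborel (E \<inter> cball x r)}"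
  have "outer_measure_le A1 (10 * sum w S / (t / 16))"
    unfolding A1_def
  proof (rule maximal_weak_type)
    fix C :: "real set" and r :: "real \<Rightarrow> real"
    assume C: "finite C" "disjoint_family_on (\<lambda>x. cball x (r x)) C"
    have "(\<Sum>x\<in>C. sum w (S \<inter> cball x (r x))) = sum w (\<Union>x\<in>C. S \<inter> cball x (r x))"
      using C \<open>finite S\<close>
      by (intro sum.UNION_disjoint[symmetric]) (auto simp: disjoint_family_on_def)
    also have "\<dots> \<le> sum w S"
      using assms by (intro sum_mono2) auto
    finally show "(\<Sum>x\<in>C. sum w (S \<inter> cball x (r x))) \<le> sum w S" .
  qed (use assms in auto)
  moreover have "outer_measure_le A2 (10 * (4 * sum w S / t) / (1 / 2))"
    unfolding A2_def
  proof (rule maximal_weak_type)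
    fix C :: "real set" and r :: "real \<Rightarrow> real"
    assume C: "finite C" "disjoint_family_on (\<lambda>x. cball x (r x)) C"
    have Em: "E \<inter> cball x (r x) \<in> fmeasurable lborel" for x
      using E by (intro fmeasurable_Int_fmeasurable) auto
    have "(\<Sum>x\<in>C. measure lborel (E \<inter> cball x (r x))) = measure lborel (\<Union>x\<in>C. E \<inter> cball x (r x))"
      using C Em by (intro measure_finite_Union[symmetric])
         (auto simp: disjoint_family_on_def fmeasurable_def top.not_eq_extremum)
    also have "\<dots> \<le> measure lborel E"
      using E C Em by (intro measure_mono_fmeasurable) (auto simp del: UN_simps intro!: sets.finite_UN dest: fmeasurableD)
    finally show "(\<Sum>x\<in>C. measure lborel (E \<inter> cball x (r x))) \<le> 4 * sum w S / t"
      using E(2) by simp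
  qed auto
  ultimately have "outer_measure_le (A1 \<union> A2) (10 * sum w S / (t / 16) + 10 * (4 * sum w S / t) / (1 / 2))"
    by (rule outer_measure_le_Un)
  then show ?thesis
  proof (rule outer_measure_le_mono)
    show "{x. \<exists>\<epsilon>>0. t < \<bar>pole_sum {s\<in>S. \<epsilon> < \<bar>s - x\<bar>} w x\<bar>} \<subseteq> A1 \<union> A2"
    proof
      fix x assume "x \<in> {x. \<exists>\<epsilon>>0. t < \<bar>pole_sum {s\<in>S. \<epsilon> < \<bar>s - x\<bar>} w x\<bar>}"
      then obtain \<epsilon> where e: "0 < \<epsilon>" "t < \<bar>pole_sum {s\<in>S. \<epsilon> < \<bar>s - x\<bar>} w x\<bar>" by blast
      show "x \<in> A1 \<union> A2"
      proof (cases "x \<in> A1")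
        case False
        then have "sum w (S \<inter> cball x r) \<le> t / 16 * r" if "0 < r" for r
          using that by (force simp: A1_def)
        then have "\<epsilon> / 2 \<le> measure lborel (E \<inter> cball x (\<epsilon> / 2))"
          unfolding E_def using assms e by (intro cotlar_density) auto
        then have "x \<in> A2"
          using e(1) unfolding A2_def by (intro CollectI exI[of _ "\<epsilon> / 2"]) auto
        then show ?thesis by blast
      qed simp
    qed
    show "10 * sum w S / (t / 16) + 10 * (4 * sum w S / t) / (1 / 2) \<le> 240 * sum w S / t"
      using \<open>0 < t\<close> by (simp add: field_simps)
  qed
qed

section \<open>The maximal inequality for integrable functions\<close>

definition hilbert_kernel :: "real \<Rightarrow> real \<Rightarrow> real" where
  "hilbert_kernel \<epsilon> u = (if \<epsilon> < \<bar>u\<bar> then 1 / u else 0)"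

text \<open>
The values may be real or complex, because the maximal inequality is reduced to nonnegative functions.
\<close>

definition trunc_hilbert :: "(real \<Rightarrow> 'a::{banach, second_countable_topology}) \<Rightarrow> real \<Rightarrow> real \<Rightarrow> 'a" where
  "trunc_hilbert f \<epsilon> x = (LINT y|lborel. hilbert_kernel \<epsilon> (y - x) *\<^sub>R f y)"

lemma hilbert_kernel_borel [measurable]: "hilbert_kernel \<epsilon> \<in> borel_measurable borel"
  unfolding hilbert_kernel_def[abs_def] by measurable

lemma abs_hilbert_kernel_le: "0 < \<epsilon> \<Longrightarrow> \<bar>hilbert_kernel \<epsilon> u\<bar> \<le> 1 / \<epsilon>"
  by (auto simp: hilbert_kernel_def intro!: divide_left_mono mult_pos_pos)

lemma isCont_hilbert_kernel:
  assumes "0 < \<epsilon>" "\<bar>u\<bar> \<noteq> \<epsilon>"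
  shows "isCont (hilbert_kernel \<epsilon>) u"
proof -
  have abs: "((\<lambda>v. \<bar>v\<bar>) \<longlongrightarrow> \<bar>u\<bar>) (nhds u)"
    by (intro tendsto_rabs filterlim_ident)
  show ?thesis
  proof (cases "\<epsilon> < \<bar>u\<bar>")
    case True
    then have "eventually (\<lambda>v. hilbert_kernel \<epsilon> v = 1 / v) (nhds u)"
      using order_tendstoD(1)[OF abs True] by (auto elim!: eventually_mono simp: hilbert_kernel_def)
    moreover have "isCont (\<lambda>v. 1 / v) u"
      using True \<open>0 < \<epsilon>\<close> by (intro continuous_intros) auto
    ultimately show ?thesis by (simp add: isCont_cong)
  next
    case False
    then have "\<bar>u\<bar> < \<epsilon>" using assms by simp
    from order_tendstoD(2)[OF abs this]
    have "eventually (\<lambda>v. hilbert_kernel \<epsilon> v = 0) (nhds u)"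
      by eventually_elim (simp add: hilbert_kernel_def)
    then show ?thesis by (simp add: isCont_cong)
  qed
qed

lemma integrable_bounded_mult:
  fixes f :: "real \<Rightarrow> 'a::{banach, second_countable_topology}"
  assumes "integrable lborel f" "k \<in> borel_measurable borel" "\<And>y. \<bar>k y\<bar> \<le> (c::real)"
  shows "integrable lborel (\<lambda>y. k y *\<^sub>R f y)"
proof (rule Bochner_Integration.integrable_bound)
  show "integrable lborel (\<lambda>y. c *\<^sub>R norm (f y))" using assms(1) by simp
  show "(\<lambda>y. k y *\<^sub>R f y) \<in> borel_measurable lborel" using assms(1,2) by simp
  show "AE y in lborel. norm (k y *\<^sub>R f y) \<le> norm (c *\<^sub>R norm (f y))"
  proof (rule AE_I2)
    fix y
    have "\<bar>k y\<bar> * norm (f y) \<le> c * norm (f y)"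
      using assms(3) by (intro mult_right_mono) auto
    then show "norm (k y *\<^sub>R f y) \<le> norm (c *\<^sub>R norm (f y))"
      by simp
  qed
qed

lemma integrable_hilbert_kernel:
  fixes f :: "real \<Rightarrow> 'a::{banach, second_countable_topology}"
  assumes "integrable lborel f" "0 < \<epsilon>"
  shows "integrable lborel (\<lambda>y. hilbert_kernel \<epsilon> (y - x) *\<^sub>R f y)"
  using assms abs_hilbert_kernel_le[OF assms(2)] by (intro integrable_bounded_mult) auto

lemma trunc_hilbert_add:
  assumes "integrable lborel f" "integrable lborel g" "0 < \<epsilon>"
  shows "trunc_hilbert (\<lambda>y. f y + g y) \<epsilon> x = trunc_hilbert f \<epsilon> x + trunc_hilbert g \<epsilon> x"
  unfolding trunc_hilbert_def scaleR_add_right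
  using assms by (intro Bochner_Integration.integral_add integrable_hilbert_kernel)

lemma trunc_hilbert_diff:
  assumes "integrable lborel f" "integrable lborel g" "0 < \<epsilon>"
  shows "trunc_hilbert (\<lambda>y. f y - g y) \<epsilon> x = trunc_hilbert f \<epsilon> x - trunc_hilbert g \<epsilon> x"
  unfolding trunc_hilbert_def scaleR_diff_right
  using assms by (intro Bochner_Integration.integral_diff integrable_hilbert_kernel)

lemma trunc_hilbert_bounded_linear:
  assumes "bounded_linear T" "integrable lborel f" "0 < \<epsilon>"
  shows "T (trunc_hilbert f \<epsilon> x) = trunc_hilbert (\<lambda>y. T (f y)) \<epsilon> x"
  unfolding trunc_hilbert_def
  using integral_bounded_linear[OF assms(1) integrable_hilbert_kernel[OF assms(2,3)]]
  by (simp add: linear_simps(5)[OF assms(1)])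

lemma integrable_level_set:
  fixes f :: "real \<Rightarrow> real"
  assumes f: "integrable lborel f" and q: "q \<in> borel_measurable borel"
  shows "integrable lborel (\<lambda>y. indicator {s::real} (q y) * f y)"
proof -
  have "(\<lambda>y. indicator {s} (q y) :: real) \<in> borel_measurable borel"
    using q by measurable
  then show ?thesis
    using integrable_bounded_mult[OF f, of "\<lambda>y. indicator {s} (q y)" 1] by simp
qed

text \<open>
Replacing the variable of integration by a function \<open>q\<close> with finitely many relevant values turns the
truncated integral into the truncated sum for the image measure under \<open>q\<close>, restricted to \<open>S\<close>.
\<close>

lemma quantised_truncation:
  fixes f :: "real \<Rightarrow> real"
  assumes f: "integrable lborel f" and q: "q \<in> borel_measurable borel" and S: "finite S"
  defines "w \<equiv> \<lambda>s. LINT y|lborel. indicator {s} (q y) * f y"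
  shows "pole_sum {s\<in>S. \<epsilon> < \<bar>s - x\<bar>} w x
       = (LINT y|lborel. indicator S (q y) * hilbert_kernel \<epsilon> (q y - x) * f y)"
proof -
  have int: "integrable lborel (\<lambda>y. indicator {s} (q y) * f y)" for s
    using integrable_level_set[OF f q] .
  have "pole_sum {s\<in>S. \<epsilon> < \<bar>s - x\<bar>} w x = (\<Sum>s\<in>S. hilbert_kernel \<epsilon> (s - x) * w s)"
    unfolding pole_sum_def hilbert_kernel_def using S by (intro sum.mono_neutral_cong_left) auto
  also have "\<dots> = (\<Sum>s\<in>S. LINT y|lborel. hilbert_kernel \<epsilon> (s - x) * (indicator {s} (q y) * f y))"
    unfolding w_def by simp
  also have "\<dots> = (LINT y|lborel. (\<Sum>s\<in>S. hilbert_kernel \<epsilon> (s - x) * (indicator {s} (q y) * f y)))"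
    using int by (intro Bochner_Integration.integral_sum[symmetric]) simp
  also have "\<dots> = (LINT y|lborel. indicator S (q y) * hilbert_kernel \<epsilon> (q y - x) * f y)"
  proof (intro Bochner_Integration.integral_cong refl)
    fix y
    have "(\<Sum>s\<in>S. hilbert_kernel \<epsilon> (s - x) * (indicator {s} (q y) * f y))
        = (\<Sum>s\<in>S. if s = q y then hilbert_kernel \<epsilon> (s - x) * f y else 0)"
      by (intro sum.cong) (auto simp: indicator_def)
    then show "(\<Sum>s\<in>S. hilbert_kernel \<epsilon> (s - x) * (indicator {s} (q y) * f y))
        = indicator S (q y) * hilbert_kernel \<epsilon> (q y - x) * f y"
      using S by (simp add: indicator_def)
  qed
  finally show ?thesis .
qed

lemma quantised_mass_le:
  fixes f q :: "real \<Rightarrow> real"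
  assumes f: "integrable lborel f" "\<And>y. 0 \<le> f y" and q: "q \<in> borel_measurable borel" and S: "finite S"
  shows "(\<Sum>s\<in>S. LINT y|lborel. indicator {s} (q y) * f y) \<le> (LINT y|lborel. f y)"
proof -
  have int: "integrable lborel (\<lambda>y. indicator {s} (q y) * f y)" for s
    using integrable_level_set[OF f(1) q] .
  have "(\<Sum>s\<in>S. LINT y|lborel. indicator {s} (q y) * f y)
      = (LINT y|lborel. (\<Sum>s\<in>S. indicator {s} (q y) * f y))"
    using int by (intro Bochner_Integration.integral_sum[symmetric]) simp
  also have "\<dots> \<le> (LINT y|lborel. f y)"
  proof (intro integral_mono Bochner_Integration.integrable_sum int f)
    fix y
    have "(\<Sum>s\<in>S. indicator {s} (q y) * f y) = (\<Sum>s\<in>S. if s = q y then f y else 0)"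
      by (intro sum.cong) (auto simp: indicator_def)
    then show "(\<Sum>s\<in>S. indicator {s} (q y) * f y) \<le> f y"
      using S f(2)[of y] by simp
  qed
  finally show ?thesis .
qed

text \<open>
Rounding to the grid of mesh \<open>1 / (n + 1)\<close> converges to the identity. Restricting the grid to \<open>[-n - 1, n + 1]\<close>
keeps it finite without affecting any fixed point in the limit.
\<close>

lemma grid_tendsto:
  fixes y :: real
  defines "q \<equiv> \<lambda>n. of_int \<lfloor>real (Suc n) * y\<rfloor> / real (Suc n)"
  shows "q \<longlonglongrightarrow> y"
    and "eventually (\<lambda>n. q n \<in> (\<lambda>k. of_int k / real (Suc n)) ` {- (int (Suc n))\<^sup>2..(int (Suc n))\<^sup>2}) sequentially"
proof -
  have fl: "real (Suc n) * y - 1 \<le> of_int \<lfloor>real (Suc n) * y\<rfloor>"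
    "of_int \<lfloor>real (Suc n) * y\<rfloor> \<le> real (Suc n) * y" for n by linarith+
  show "q \<longlonglongrightarrow> y"
  proof (rule tendsto_sandwich)
    show "(\<lambda>n. y - 1 / real (Suc n)) \<longlonglongrightarrow> y" by real_asymp
    show "(\<lambda>n. y) \<longlonglongrightarrow> y" by simp
    show "eventually (\<lambda>n. y - 1 / real (Suc n) \<le> q n) sequentially"
    proof (intro always_eventually allI)
      fix n
      have "(real (Suc n) * y - 1) / real (Suc n) \<le> q n"
        unfolding q_def using fl(1) by (intro divide_right_mono) auto
      moreover have "(real (Suc n) * y - 1) / real (Suc n) = y - 1 / real (Suc n)"
        by (simp add: diff_divide_distrib del: of_nat_Suc)
      ultimately show "y - 1 / real (Suc n) \<le> q n" by simp
    qed
    show "eventually (\<lambda>n. q n \<le> y) sequentially"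
      using fl(2) by (intro always_eventually allI) (simp add: q_def pos_divide_le_eq mult.commute del: of_nat_Suc)
  qed
  obtain N :: nat where N: "\<bar>y\<bar> \<le> real N" using real_arch_simple by blast
  show "eventually (\<lambda>n. q n \<in> (\<lambda>k. of_int k / real (Suc n)) ` {- (int (Suc n))\<^sup>2..(int (Suc n))\<^sup>2}) sequentially"
    using eventually_ge_at_top[of N]
  proof eventually_elim
    case (elim n)
    have "real (Suc n) * \<bar>y\<bar> \<le> real (Suc n) * real n"
      using N elim by (intro mult_left_mono) auto
    also have "\<dots> \<le> (real (Suc n))\<^sup>2 - 1"
      by (simp add: power2_eq_square algebra_simps)
    also have "real (Suc n) * \<bar>y\<bar> = \<bar>real (Suc n) * y\<bar>"
      by (simp add: abs_mult del: of_nat_Suc)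
    finally have "\<bar>real (Suc n) * y\<bar> + 1 \<le> (real (Suc n))\<^sup>2" by simp
    then have "of_int \<lfloor>real (Suc n) * y\<rfloor> \<le> (real (Suc n))\<^sup>2"
      "- (real (Suc n))\<^sup>2 \<le> of_int \<lfloor>real (Suc n) * y\<rfloor>"
      using fl[of n] by linarith+
    then have "real_of_int \<lfloor>real (Suc n) * y\<rfloor> \<le> real_of_int ((int (Suc n))\<^sup>2)"
      "real_of_int (- (int (Suc n))\<^sup>2) \<le> real_of_int \<lfloor>real (Suc n) * y\<rfloor>"
      by (simp_all del: of_nat_Suc)
    then show ?case
      unfolding q_def of_int_le_iff by (intro imageI) simp
  qed
qed

text \<open>
For fixed \<open>x\<close> and \<open>\<epsilon>\<close> the kernel is bounded and is discontinuous only at the two points \<open>x \<plusminus> \<epsilon>\<close>, a null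
set, so the discretised truncations converge by dominated convergence. The discrete inequality has a
constant that does not depend on the grid and therefore passes to the limit.
\<close>

lemma trunc_hilbert_maximal_nonneg:
  fixes f :: "real \<Rightarrow> real"
  assumes f: "integrable lborel f" "\<And>y. 0 \<le> f y" and "0 < t"
  shows "outer_measure_le {x. \<exists>\<epsilon>>0. t < \<bar>trunc_hilbert f \<epsilon> x\<bar>} (240 * (LINT y|lborel. f y) / t)"
proof -
  define q :: "nat \<Rightarrow> real \<Rightarrow> real" where "q n y = of_int \<lfloor>real (Suc n) * y\<rfloor> / real (Suc n)" for n y
  define S :: "nat \<Rightarrow> real set"
    where "S n = (\<lambda>k. of_int k / real (Suc n)) ` {- (int (Suc n))\<^sup>2..(int (Suc n))\<^sup>2}" for n
  define w where "w n s = (LINT y|lborel. indicator {s} (q n y) * f y)" for n s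
  have w_eq: "w n = (\<lambda>s. LINT y|lborel. indicator {s} (q n y) * f y)" for n
    by (simp add: w_def fun_eq_iff)
  have q[measurable]: "q n \<in> borel_measurable borel" for n
    unfolding q_def[abs_def] by measurable
  have S: "finite (S n)" for n by (simp add: S_def)
  define X where "X n = {x. \<exists>\<epsilon>>0. t < \<bar>pole_sum {s\<in>S n. \<epsilon> < \<bar>s - x\<bar>} (w n) x\<bar>}" for n
  have wnn: "0 \<le> w n s" for n s
    unfolding w_def using f(2) by (intro integral_nonneg_AE) auto
  have "outer_measure_le (X n) (240 * (LINT y|lborel. f y) / t)" for n
  proof (rule outer_measure_le_mono)
    show "outer_measure_le (X n) (240 * sum (w n) (S n) / t)"
      unfolding X_def using S wnn \<open>0 < t\<close> by (intro discrete_maximal_weak_type)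
    show "240 * sum (w n) (S n) / t \<le> 240 * (LINT y|lborel. f y) / t"
      using quantised_mass_le[OF f q S] \<open>0 < t\<close>
      by (intro divide_right_mono mult_left_mono) (auto simp: w_def)
  qed simp
  then have "outer_measure_le {x. eventually (\<lambda>n. x \<in> X n) sequentially} (240 * (LINT y|lborel. f y) / t)"
    by (rule outer_measure_le_eventually)
  then show ?thesis
  proof (rule outer_measure_le_mono)
    show "{x. \<exists>\<epsilon>>0. t < \<bar>trunc_hilbert f \<epsilon> x\<bar>} \<subseteq> {x. eventually (\<lambda>n. x \<in> X n) sequentially}"
    proof clarify
      fix x \<epsilon> :: real assume e: "0 < \<epsilon>" "t < \<bar>trunc_hilbert f \<epsilon> x\<bar>"
      have "(\<lambda>n. LINT y|lborel. indicator (S n) (q n y) * hilbert_kernel \<epsilon> (q n y - x) * f y)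
          \<longlonglongrightarrow> (LINT y|lborel. hilbert_kernel \<epsilon> (y - x) *\<^sub>R f y)"
      proof (rule integral_dominated_convergence[where w = "\<lambda>y. f y / \<epsilon>"])
        show "AE y in lborel. (\<lambda>n. indicator (S n) (q n y) * hilbert_kernel \<epsilon> (q n y - x) * f y)
            \<longlonglongrightarrow> hilbert_kernel \<epsilon> (y - x) *\<^sub>R f y"
        proof -
          have "AE y in lborel. y \<noteq> x + \<epsilon>" "AE y in lborel. y \<noteq> x - \<epsilon>"
            by (rule AE_lborel_singleton)+
          then show ?thesis
          proof eventually_elim
            case (elim y)
            then have "isCont (hilbert_kernel \<epsilon>) (y - x)"
              using \<open>0 < \<epsilon>\<close> by (intro isCont_hilbert_kernel) (auto simp: abs_if)
            moreover have "(\<lambda>n. q n y - x) \<longlonglongrightarrow> y - x"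
              unfolding q_def by (intro tendsto_intros grid_tendsto)
            ultimately have "(\<lambda>n. hilbert_kernel \<epsilon> (q n y - x)) \<longlonglongrightarrow> hilbert_kernel \<epsilon> (y - x)"
              by (rule isCont_tendsto_compose)
            then have "(\<lambda>n. hilbert_kernel \<epsilon> (q n y - x) * f y) \<longlonglongrightarrow> hilbert_kernel \<epsilon> (y - x) *\<^sub>R f y"
              by (simp add: tendsto_mult_right)
            moreover have "eventually (\<lambda>n. q n y \<in> S n) sequentially"
              unfolding q_def S_def by (rule grid_tendsto)
            then have "eventually (\<lambda>n. hilbert_kernel \<epsilon> (q n y - x) * f y
                = indicator (S n) (q n y) * hilbert_kernel \<epsilon> (q n y - x) * f y) sequentially"
              by eventually_elim simp
            ultimately show ?case by (rule Lim_transform_eventually)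
          qed
        qed
        show "integrable lborel (\<lambda>y. f y / \<epsilon>)" using f by simp
        show "AE y in lborel. norm (indicator (S n) (q n y) * hilbert_kernel \<epsilon> (q n y - x) * f y) \<le> f y / \<epsilon>" for n
        proof (rule AE_I2)
          fix y
          have "\<bar>indicator (S n) (q n y) * hilbert_kernel \<epsilon> (q n y - x)\<bar> \<le> 1 / \<epsilon>"
            using abs_hilbert_kernel_le[OF e(1), of "q n y - x"] e(1) by (simp add: indicator_def)
          from mult_right_mono[OF this f(2)[of y]]
          show "norm (indicator (S n) (q n y) * hilbert_kernel \<epsilon> (q n y - x) * f y) \<le> f y / \<epsilon>"
            using f(2)[of y] by (simp add: abs_mult)
        qed
        have [measurable]: "S n \<in> sets borel" for n
          using S by (simp add: finite_imp_closed borel_closed)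
        have [measurable]: "f \<in> borel_measurable borel" using f(1) by auto
        show "(\<lambda>y. hilbert_kernel \<epsilon> (y - x) *\<^sub>R f y) \<in> borel_measurable lborel" by measurable
        show "(\<lambda>y. indicator (S n) (q n y) * hilbert_kernel \<epsilon> (q n y - x) * f y) \<in> borel_measurable lborel" for n
          by measurable
      qed
      then have "(\<lambda>n. \<bar>pole_sum {s\<in>S n. \<epsilon> < \<bar>s - x\<bar>} (w n) x\<bar>) \<longlonglongrightarrow> \<bar>trunc_hilbert f \<epsilon> x\<bar>"
        unfolding trunc_hilbert_def w_eq quantised_truncation[OF f(1) q S]
        by (rule tendsto_rabs)
      then have "eventually (\<lambda>n. t < \<bar>pole_sum {s\<in>S n. \<epsilon> < \<bar>s - x\<bar>} (w n) x\<bar>) sequentially"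
        using e(2) order_tendstoD(1) by blast
      then show "eventually (\<lambda>n. x \<in> X n) sequentially"
        using e(1) unfolding X_def by (auto elim!: eventually_mono)
    qed
  qed simp
qed

lemma trunc_hilbert_maximal_real:
  fixes f :: "real \<Rightarrow> real"
  assumes f: "integrable lborel f" and "0 < t"
  shows "outer_measure_le {x. \<exists>\<epsilon>>0. t < \<bar>trunc_hilbert f \<epsilon> x\<bar>} (480 * (LINT y|lborel. \<bar>f y\<bar>) / t)"
proof -
  define p n where "p y = max 0 (f y)" and "n y = max 0 (- f y)" for y
  have int: "integrable lborel p" "integrable lborel n"
    unfolding p_def n_def using f by (auto intro!: integrable_max)
  have "outer_measure_le ({x. \<exists>\<epsilon>>0. t / 2 < \<bar>trunc_hilbert p \<epsilon> x\<bar>} \<union> {x. \<exists>\<epsilon>>0. t / 2 < \<bar>trunc_hilbert n \<epsilon> x\<bar>})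
     (240 * (LINT y|lborel. p y) / (t / 2) + 240 * (LINT y|lborel. n y) / (t / 2))"
    using int \<open>0 < t\<close> by (intro outer_measure_le_Un trunc_hilbert_maximal_nonneg) (auto simp: p_def n_def)
  then show ?thesis
  proof (rule outer_measure_le_mono)
    have "f = (\<lambda>y. p y - n y)" by (auto simp: p_def n_def)
    then have "trunc_hilbert f \<epsilon> x = trunc_hilbert p \<epsilon> x - trunc_hilbert n \<epsilon> x" if "0 < \<epsilon>" for \<epsilon> x
      using trunc_hilbert_diff[OF int that] by metis
    then have "t / 2 < \<bar>trunc_hilbert p \<epsilon> x\<bar> \<or> t / 2 < \<bar>trunc_hilbert n \<epsilon> x\<bar>"
      if "0 < \<epsilon>" "t < \<bar>trunc_hilbert f \<epsilon> x\<bar>" for \<epsilon> x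
      using that by (auto simp: abs_if split: if_splits)
    then show "{x. \<exists>\<epsilon>>0. t < \<bar>trunc_hilbert f \<epsilon> x\<bar>}
        \<subseteq> {x. \<exists>\<epsilon>>0. t / 2 < \<bar>trunc_hilbert p \<epsilon> x\<bar>} \<union> {x. \<exists>\<epsilon>>0. t / 2 < \<bar>trunc_hilbert n \<epsilon> x\<bar>}"
      by blast
    have "(LINT y|lborel. \<bar>f y\<bar>) = (LINT y|lborel. p y + n y)"
      by (intro Bochner_Integration.integral_cong) (auto simp: p_def n_def)
    also have "\<dots> = (LINT y|lborel. p y) + (LINT y|lborel. n y)"
      using int by (rule Bochner_Integration.integral_add)
    finally show "240 * (LINT y|lborel. p y) / (t / 2) + 240 * (LINT y|lborel. n y) / (t / 2)
        \<le> 480 * (LINT y|lborel. \<bar>f y\<bar>) / t"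
      using \<open>0 < t\<close> by (simp add: field_simps)
  qed
qed

lemma trunc_hilbert_maximal:
  fixes f :: "real \<Rightarrow> complex"
  assumes f: "integrable lborel f" and "0 < t"
  shows "outer_measure_le {x. \<exists>\<epsilon>>0. t < cmod (trunc_hilbert f \<epsilon> x)} (1920 * (LINT y|lborel. cmod (f y)) / t)"
proof -
  have int: "integrable lborel (\<lambda>y. Re (f y))" "integrable lborel (\<lambda>y. Im (f y))"
    using f by auto
  have "outer_measure_le ({x. \<exists>\<epsilon>>0. t / 2 < \<bar>trunc_hilbert (\<lambda>y. Re (f y)) \<epsilon> x\<bar>}
        \<union> {x. \<exists>\<epsilon>>0. t / 2 < \<bar>trunc_hilbert (\<lambda>y. Im (f y)) \<epsilon> x\<bar>})
     (480 * (LINT y|lborel. \<bar>Re (f y)\<bar>) / (t / 2) + 480 * (LINT y|lborel. \<bar>Im (f y)\<bar>) / (t / 2))"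
    using int \<open>0 < t\<close> by (intro outer_measure_le_Un trunc_hilbert_maximal_real) auto
  then show ?thesis
  proof (rule outer_measure_le_mono)
    have "t / 2 < \<bar>trunc_hilbert (\<lambda>y. Re (f y)) \<epsilon> x\<bar> \<or> t / 2 < \<bar>trunc_hilbert (\<lambda>y. Im (f y)) \<epsilon> x\<bar>"
      if "0 < \<epsilon>" "t < cmod (trunc_hilbert f \<epsilon> x)" for \<epsilon> x
      using that(2) cmod_le[of "trunc_hilbert f \<epsilon> x"]
        trunc_hilbert_bounded_linear[OF bounded_linear_Re f that(1), of x]
        trunc_hilbert_bounded_linear[OF bounded_linear_Im f that(1), of x] by auto
    then show "{x. \<exists>\<epsilon>>0. t < cmod (trunc_hilbert f \<epsilon> x)}
        \<subseteq> {x. \<exists>\<epsilon>>0. t / 2 < \<bar>trunc_hilbert (\<lambda>y. Re (f y)) \<epsilon> x\<bar>}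
          \<union> {x. \<exists>\<epsilon>>0. t / 2 < \<bar>trunc_hilbert (\<lambda>y. Im (f y)) \<epsilon> x\<bar>}"
      by blast
    have "(LINT y|lborel. \<bar>Re (f y)\<bar>) \<le> (LINT y|lborel. cmod (f y))"
      "(LINT y|lborel. \<bar>Im (f y)\<bar>) \<le> (LINT y|lborel. cmod (f y))"
      using f int by (auto intro!: integral_mono abs_Re_le_cmod abs_Im_le_cmod)
    then have "960 * ((LINT y|lborel. \<bar>Re (f y)\<bar>) + (LINT y|lborel. \<bar>Im (f y)\<bar>)) / t
        \<le> 960 * (2 * (LINT y|lborel. cmod (f y))) / t"
      using \<open>0 < t\<close> by (intro divide_right_mono) auto
    then show "480 * (LINT y|lborel. \<bar>Re (f y)\<bar>) / (t / 2) + 480 * (LINT y|lborel. \<bar>Im (f y)\<bar>) / (t / 2)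
        \<le> 1920 * (LINT y|lborel. cmod (f y)) / t"
      using \<open>0 < t\<close> by (simp add: add_divide_distrib distrib_left)
  qed
qed

section \<open>Existence of the principal value almost everywhere\<close>

text \<open>
The Cauchy property of the truncations is equivalent to convergence, and it is a statement about
oscillation: an \<open>L\<^sup>1\<close> perturbation changes the oscillation by at most twice the maximal truncation.
\<close>

definition pv_cauchy :: "(real \<Rightarrow> complex) \<Rightarrow> real \<Rightarrow> bool" where
  "pv_cauchy f x \<longleftrightarrow> (\<forall>\<eta>>0. \<exists>d>0. \<forall>\<epsilon>\<in>{0<..<d}. \<forall>\<epsilon>'\<in>{0<..<d}.
     cmod (trunc_hilbert f \<epsilon> x - trunc_hilbert f \<epsilon>' x) \<le> \<eta>)"

lemma pv_cauchy_imp_convergent: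
  assumes "pv_cauchy f x"
  shows "\<exists>l. ((\<lambda>\<epsilon>. trunc_hilbert f \<epsilon> x) \<longlongrightarrow> l) (at_right 0)"
proof -
  let ?T = "\<lambda>\<epsilon>. trunc_hilbert f \<epsilon> x"
  have "cauchy_filter (filtermap ?T (at_right 0))"
    unfolding cauchy_filter_metric_filtermap
  proof (intro allI impI)
    fix e :: real assume "0 < e"
    then have "0 < e / 2" by simp
    then obtain d where d: "0 < d" "\<forall>\<epsilon>\<in>{0<..<d}. \<forall>\<epsilon>'\<in>{0<..<d}. cmod (?T \<epsilon> - ?T \<epsilon>') \<le> e / 2"
      using assms unfolding pv_cauchy_def by blast
    have "dist (?T \<epsilon>) (?T \<epsilon>') < e" if "\<epsilon> \<in> {0<..<d}" "\<epsilon>' \<in> {0<..<d}" for \<epsilon> \<epsilon>'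
      using d(2) that \<open>0 < e\<close> by (smt (verit) dist_norm field_sum_of_halves)
    moreover have "eventually (\<lambda>\<epsilon>. \<epsilon> \<in> {0<..<d}) (at_right 0)"
      using eventually_at_right_real[OF d(1)] .
    ultimately show "\<exists>P. eventually P (at_right 0) \<and> (\<forall>x y. P x \<and> P y \<longrightarrow> dist (?T x) (?T y) < e)"
      by blast
  qed
  moreover have "complete (UNIV :: complex set)"
    by (meson Cauchy_convergent UNIV_I complete_def convergent_def)
  ultimately show ?thesis
    using complete_uniform[where S = "UNIV :: complex set"] by (force simp: filterlim_def)
qed

lemma pv_cauchy_add:
  assumes "integrable lborel f" "integrable lborel g" "pv_cauchy f x" "pv_cauchy g x"
  shows "pv_cauchy (\<lambda>y. f y + g y) x"
  unfolding pv_cauchy_def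
proof (intro allI impI)
  fix \<eta> :: real assume "0 < \<eta>"
  then have "0 < \<eta> / 2" by simp
  obtain d where d: "0 < d" "\<And>\<epsilon> \<epsilon>'. \<epsilon> \<in> {0<..<d} \<Longrightarrow> \<epsilon>' \<in> {0<..<d} \<Longrightarrow>
      cmod (trunc_hilbert f \<epsilon> x - trunc_hilbert f \<epsilon>' x) \<le> \<eta> / 2"
    using assms(3) \<open>0 < \<eta> / 2\<close> unfolding pv_cauchy_def by blast
  obtain d' where d': "0 < d'" "\<And>\<epsilon> \<epsilon>'. \<epsilon> \<in> {0<..<d'} \<Longrightarrow> \<epsilon>' \<in> {0<..<d'} \<Longrightarrow>
      cmod (trunc_hilbert g \<epsilon> x - trunc_hilbert g \<epsilon>' x) \<le> \<eta> / 2"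
    using assms(4) \<open>0 < \<eta> / 2\<close> unfolding pv_cauchy_def by blast
  show "\<exists>d>0. \<forall>\<epsilon>\<in>{0<..<d}. \<forall>\<epsilon>'\<in>{0<..<d}.
     cmod (trunc_hilbert (\<lambda>y. f y + g y) \<epsilon> x - trunc_hilbert (\<lambda>y. f y + g y) \<epsilon>' x) \<le> \<eta>"
  proof (intro exI[of _ "min d d'"] conjI ballI)
    fix \<epsilon> \<epsilon>' assume e: "\<epsilon> \<in> {0<..<min d d'}" "\<epsilon>' \<in> {0<..<min d d'}"
    have "trunc_hilbert (\<lambda>y. f y + g y) \<epsilon> x - trunc_hilbert (\<lambda>y. f y + g y) \<epsilon>' x
       = (trunc_hilbert f \<epsilon> x - trunc_hilbert f \<epsilon>' x) + (trunc_hilbert g \<epsilon> x - trunc_hilbert g \<epsilon>' x)"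
      using e assms by (simp add: trunc_hilbert_add)
    also have "cmod \<dots> \<le> \<eta> / 2 + \<eta> / 2"
      using e d(2)[of \<epsilon> \<epsilon>'] d'(2)[of \<epsilon> \<epsilon>'] by (intro norm_triangle_mono) auto
    finally show "cmod (trunc_hilbert (\<lambda>y. f y + g y) \<epsilon> x - trunc_hilbert (\<lambda>y. f y + g y) \<epsilon>' x) \<le> \<eta>"
      by simp
  qed (use d d' in auto)
qed

text \<open>
The difference of two kernels is odd with compact support, so its integral vanishes and \<open>f x\<close> may be
subtracted from \<open>f y\<close>; the Lipschitz bound then cancels the singularity.
\<close>

lemma trunc_hilbert_difference_lipschitz:
  assumes f: "integrable lborel f" and lip: "\<And>u v. cmod (f u - f v) \<le> L * \<bar>u - v\<bar>"
    and e: "0 < \<epsilon>" "\<epsilon> \<le> \<epsilon>'"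
  shows "cmod (trunc_hilbert f \<epsilon> x - trunc_hilbert f \<epsilon>' x) \<le> 2 * L * \<epsilon>'"
proof -
  define k where "k u = hilbert_kernel \<epsilon> u - hilbert_kernel \<epsilon>' u" for u
  have [measurable]: "k \<in> borel_measurable borel" unfolding k_def[abs_def] by measurable
  have k: "k u = (if \<epsilon> < \<bar>u\<bar> \<and> \<bar>u\<bar> \<le> \<epsilon>' then 1 / u else 0)" for u
    using e by (auto simp: k_def hilbert_kernel_def)
  have "0 \<le> L" using order_trans[OF norm_ge_zero lip[of 0 1]] by simp
  have intI: "integrable lborel (indicator {x-\<epsilon>'..x+\<epsilon>'} :: real \<Rightarrow> real)"
    by (intro integrable_real_indicator) (simp_all add: emeasure_lborel_Icc_eq)
  have kf: "integrable lborel (\<lambda>y. k (y - x) *\<^sub>R f y)"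
    unfolding k_def scaleR_diff_left
    using f e by (intro Bochner_Integration.integrable_diff integrable_hilbert_kernel) auto
  have kint: "integrable lborel (\<lambda>y. k (y - x))"
  proof (rule Bochner_Integration.integrable_bound)
    show "integrable lborel (\<lambda>y. (1 / \<epsilon>) * indicator {x-\<epsilon>'..x+\<epsilon>'} y :: real)" using intI by simp
    show "AE y in lborel. norm (k (y - x)) \<le> norm ((1 / \<epsilon>) * indicator {x-\<epsilon>'..x+\<epsilon>'} y :: real)"
      using e by (intro AE_I2) (auto simp: k indicator_def abs_if field_simps split: if_splits)
  qed measurable
  have odd: "(LINT y|lborel. k (y - x)) = 0"
  proof -
    have "(LINT y|lborel. k (y - x)) = (LINT y|lborel. k ((2 * x + (-1) * y) - x))"
      using lborel_integral_real_affine[of "-1" "\<lambda>y. k (y - x)" "2 * x"] by simp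
    also have "\<dots> = (LINT y|lborel. - k (y - x))"
      by (intro Bochner_Integration.integral_cong) (auto simp: k abs_minus_commute divide_simps)
    finally show ?thesis by simp
  qed
  have "trunc_hilbert f \<epsilon> x - trunc_hilbert f \<epsilon>' x = (LINT y|lborel. k (y - x) *\<^sub>R f y)"
    unfolding trunc_hilbert_def k_def scaleR_diff_left
    using f e by (intro Bochner_Integration.integral_diff[symmetric] integrable_hilbert_kernel) auto
  also have "\<dots> = (LINT y|lborel. k (y - x) *\<^sub>R f y) - (LINT y|lborel. k (y - x) *\<^sub>R f x)"
    using kint odd by simp
  also have "\<dots> = (LINT y|lborel. k (y - x) *\<^sub>R f y - k (y - x) *\<^sub>R f x)"
    using kf kint by (intro Bochner_Integration.integral_diff[symmetric]) auto
  also have "cmod \<dots> \<le> (LINT y|lborel. L * indicator {x-\<epsilon>'..x+\<epsilon>'} y)"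
  proof (rule Bochner_Integration.integral_norm_bound_integral)
    show "integrable lborel (\<lambda>y. k (y - x) *\<^sub>R f y - k (y - x) *\<^sub>R f x)" using kf kint by auto
    show "integrable lborel (\<lambda>y. L * indicator {x-\<epsilon>'..x+\<epsilon>'} y :: real)" using intI by simp
    fix y
    show "norm (k (y - x) *\<^sub>R f y - k (y - x) *\<^sub>R f x) \<le> L * indicator {x-\<epsilon>'..x+\<epsilon>'} y"
    proof (cases "\<epsilon> < \<bar>y - x\<bar> \<and> \<bar>y - x\<bar> \<le> \<epsilon>'")
      case True
      have "norm (k (y - x) *\<^sub>R f y - k (y - x) *\<^sub>R f x) = cmod (f y - f x) / \<bar>y - x\<bar>"
        using True by (simp add: k scaleR_diff_right[symmetric])
      also have "\<dots> \<le> L"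
        using True e lip[of y x] \<open>0 \<le> L\<close> by (simp add: divide_le_eq)
      finally show ?thesis using True by (simp add: indicator_def abs_le_iff)
    next
      case False
      then have "k (y - x) = 0" by (auto simp: k)
      then show ?thesis using \<open>0 \<le> L\<close> by simp
    qed
  qed
  also have "\<dots> = 2 * L * \<epsilon>'" using e by simp
  finally show ?thesis .
qed

lemma pv_cauchy_lipschitz:
  assumes f: "integrable lborel f" and lip: "\<And>u v. cmod (f u - f v) \<le> L * \<bar>u - v\<bar>"
  shows "pv_cauchy f x"
  unfolding pv_cauchy_def
proof (intro allI impI)
  fix \<eta> :: real assume "0 < \<eta>"
  have "0 \<le> L" using order_trans[OF norm_ge_zero lip[of 0 1]] by simp
  define d where "d = \<eta> / (2 * L + 1)"
  have "0 < d" using \<open>0 < \<eta>\<close> \<open>0 \<le> L\<close> by (simp add: d_def)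
  have le: "2 * L * \<delta> \<le> \<eta>" if "\<delta> < d" "0 < \<delta>" for \<delta>
  proof -
    have "2 * L * \<delta> \<le> (2 * L + 1) * d" using that \<open>0 \<le> L\<close> by (intro mult_mono) auto
    then show ?thesis using \<open>0 \<le> L\<close> by (simp add: d_def)
  qed
  show "\<exists>d>0. \<forall>\<epsilon>\<in>{0<..<d}. \<forall>\<epsilon>'\<in>{0<..<d}. cmod (trunc_hilbert f \<epsilon> x - trunc_hilbert f \<epsilon>' x) \<le> \<eta>"
  proof (intro exI[of _ d] conjI ballI \<open>0 < d\<close>)
    fix \<epsilon> \<epsilon>' assume e: "\<epsilon> \<in> {0<..<d}" "\<epsilon>' \<in> {0<..<d}"
    show "cmod (trunc_hilbert f \<epsilon> x - trunc_hilbert f \<epsilon>' x) \<le> \<eta>"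
    proof (cases "\<epsilon> \<le> \<epsilon>'")
      case True
      then show ?thesis
        using trunc_hilbert_difference_lipschitz[OF f lip, of \<epsilon> \<epsilon>' x] le[of \<epsilon>'] e by force
    next
      case False
      then show ?thesis
        using trunc_hilbert_difference_lipschitz[OF f lip, of \<epsilon>' \<epsilon> x] le[of \<epsilon>] e
        by (force simp: norm_minus_commute)
    qed
  qed
qed

text \<open>
The set where the oscillation at \<open>0\<close> exceeds \<open>\<eta>\<close> is, up to a null set, contained in the set where the
maximal truncation of \<open>f - g\<close> exceeds \<open>\<eta> / 3\<close>. Its measure is arbitrarily small because \<open>g\<close> is
arbitrarily close to \<open>f\<close>.
\<close>

lemma pv_cauchy_L1_closed:
  assumes f: "integrable lborel f"
    and approx: "\<And>\<delta>. 0 < \<delta> \<Longrightarrow> \<exists>g. integrable lborel g \<and> (AE x in lborel. pv_cauchy g x)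
        \<and> (LINT y|lborel. cmod (f y - g y)) \<le> \<delta>"
  shows "AE x in lborel. pv_cauchy f x"
proof -
  define Q where "Q \<eta> x \<longleftrightarrow> (\<exists>d>0. \<forall>\<epsilon>\<in>{0<..<d}. \<forall>\<epsilon>'\<in>{0<..<d}.
     cmod (trunc_hilbert f \<epsilon> x - trunc_hilbert f \<epsilon>' x) \<le> \<eta>)" for \<eta> x
  have ae: "AE x in lborel. Q \<eta> x" if "0 < \<eta>" for \<eta>
  proof (rule outer_measure_le_arbitrary_imp_AE)
    fix e :: real assume "0 < e"
    \<comment> \<open>chosen so that the maximal inequality at height \<open>\<eta> / 3\<close> gives exactly \<open>e\<close>\<close>
    define \<delta> where "\<delta> = e * \<eta> / 5760"
    have "0 < \<delta>" using \<open>0 < e\<close> \<open>0 < \<eta>\<close> by (simp add: \<delta>_def)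
    then obtain g where g: "integrable lborel g" "AE x in lborel. pv_cauchy g x"
        "(LINT y|lborel. cmod (f y - g y)) \<le> \<delta>"
      using approx by blast
    define X where "X = {x. \<exists>\<epsilon>>0. \<eta> / 3 < cmod (trunc_hilbert (\<lambda>y. f y - g y) \<epsilon> x)}"
    have "outer_measure_le X (1920 * (LINT y|lborel. cmod (f y - g y)) / (\<eta> / 3))"
      unfolding X_def using f g(1) \<open>0 < \<eta>\<close> by (intro trunc_hilbert_maximal) auto
    from outer_measure_le_Un[OF AE_imp_outer_le_0[OF g(2)] this]
    show "outer_measure_le {x. \<not> Q \<eta> x} e"
    proof (rule outer_measure_le_mono)
      have "1920 * (LINT y|lborel. cmod (f y - g y)) / (\<eta> / 3) \<le> 1920 * \<delta> / (\<eta> / 3)"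
        using g(3) \<open>0 < \<eta>\<close> by (intro divide_right_mono mult_left_mono) auto
      also have "\<dots> = e" using \<open>0 < \<eta>\<close> by (simp add: \<delta>_def)
      finally show "0 + 1920 * (LINT y|lborel. cmod (f y - g y)) / (\<eta> / 3) \<le> e" by simp
      show "{x. \<not> Q \<eta> x} \<subseteq> {x. \<not> pv_cauchy g x} \<union> X"
      proof (rule subsetI, rule ccontr)
        fix x assume x: "x \<in> {x. \<not> Q \<eta> x}" and n: "x \<notin> {x. \<not> pv_cauchy g x} \<union> X"
        have small: "cmod (trunc_hilbert f \<epsilon> x - trunc_hilbert g \<epsilon> x) \<le> \<eta> / 3" if "0 < \<epsilon>" for \<epsilon>
          using n that trunc_hilbert_diff[OF f g(1) that, of x] by (force simp: X_def)
        have "pv_cauchy g x" using n by simp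
        then obtain d where d: "0 < d" "\<And>\<epsilon> \<epsilon>'. \<epsilon> \<in> {0<..<d} \<Longrightarrow> \<epsilon>' \<in> {0<..<d} \<Longrightarrow>
            cmod (trunc_hilbert g \<epsilon> x - trunc_hilbert g \<epsilon>' x) \<le> \<eta> / 3"
          unfolding pv_cauchy_def using \<open>0 < \<eta>\<close> by (metis divide_pos_pos zero_less_numeral)
        have "cmod (trunc_hilbert f \<epsilon> x - trunc_hilbert f \<epsilon>' x) \<le> \<eta>"
          if e: "\<epsilon> \<in> {0<..<d}" "\<epsilon>' \<in> {0<..<d}" for \<epsilon> \<epsilon>'
        proof -
          have "trunc_hilbert f \<epsilon> x - trunc_hilbert f \<epsilon>' x = (trunc_hilbert f \<epsilon> x - trunc_hilbert g \<epsilon> x)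
              + ((trunc_hilbert g \<epsilon> x - trunc_hilbert g \<epsilon>' x) - (trunc_hilbert f \<epsilon>' x - trunc_hilbert g \<epsilon>' x))"
            by simp
          also have "cmod \<dots> \<le> \<eta> / 3 + (\<eta> / 3 + \<eta> / 3)"
            using e by (intro order_trans[OF norm_triangle_ineq add_mono]
                order_trans[OF norm_triangle_ineq4 add_mono] small d(2)) auto
          finally show ?thesis by simp
        qed
        then have "Q \<eta> x" unfolding Q_def using d(1) by blast
        with x show False by simp
      qed
    qed
  qed
  have "AE x in lborel. \<forall>n::nat. Q (1 / real (Suc n)) x"
    using ae by (simp add: AE_all_countable)
  then show ?thesis
  proof eventually_elim
    case (elim x)
    show ?case
      unfolding pv_cauchy_def
    proof (intro allI impI)
      fix \<eta> :: real assume "0 < \<eta>"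
      then obtain n where "1 / real (Suc n) < \<eta>" using nat_approx_posE by metis
      moreover obtain d where "d > 0" "\<forall>\<epsilon>\<in>{0<..<d}. \<forall>\<epsilon>'\<in>{0<..<d}.
          cmod (trunc_hilbert f \<epsilon> x - trunc_hilbert f \<epsilon>' x) \<le> 1 / real (Suc n)"
        using elim unfolding Q_def by blast
      ultimately show "\<exists>d>0. \<forall>\<epsilon>\<in>{0<..<d}. \<forall>\<epsilon>'\<in>{0<..<d}.
          cmod (trunc_hilbert f \<epsilon> x - trunc_hilbert f \<epsilon>' x) \<le> \<eta>"
        by (meson less_imp_le order_trans)
    qed
  qed
qed

lemma pv_cauchy_dominated_limit:
  assumes f: "f \<in> borel_measurable lborel" and s: "\<And>i::nat. integrable lborel (s i)" "\<And>i. AE x in lborel. pv_cauchy (s i) x"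
    and lim: "\<And>y. (\<lambda>i. s i y) \<longlonglongrightarrow> f y" and w: "integrable lborel w" "\<And>i y. cmod (s i y) \<le> w y"
  shows "AE x in lborel. pv_cauchy f x"
proof -
  have sm: "s i \<in> borel_measurable lborel" for i
    by (rule borel_measurable_integrable[OF s(1)])
  have f: "integrable lborel f"
    using f sm w lim by (intro integrable_dominated_convergence[where w = w and s = s]) auto
  have "(\<lambda>i. LINT y|lborel. cmod (f y - s i y)) \<longlonglongrightarrow> (LINT y|(lborel :: real measure). 0)"
  proof (rule integral_dominated_convergence[where w = "\<lambda>y. cmod (f y) + w y"])
    show "AE y in lborel. (\<lambda>i. cmod (f y - s i y)) \<longlonglongrightarrow> 0"
    proof (rule AE_I2)
      fix y
      have "(\<lambda>i. cmod (f y - s i y)) \<longlonglongrightarrow> cmod (f y - f y)"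
        by (intro tendsto_intros lim)
      then show "(\<lambda>i. cmod (f y - s i y)) \<longlonglongrightarrow> 0" by simp
    qed
    show "AE y in lborel. norm (cmod (f y - s i y)) \<le> cmod (f y) + w y" for i
      using w(2)[of i] by (auto intro!: AE_I2 order_trans[OF norm_triangle_ineq4])
  qed (use f s(1) w in auto)
  then have lim0: "(\<lambda>i. LINT y|lborel. cmod (f y - s i y)) \<longlonglongrightarrow> 0" by simp
  show ?thesis
  proof (rule pv_cauchy_L1_closed[OF f])
    fix \<delta> :: real assume "0 < \<delta>"
    then obtain i where "(LINT y|lborel. cmod (f y - s i y)) < \<delta>"
      using order_tendstoD(2)[OF lim0] eventually_happens'[OF sequentially_bot] by blast
    then show "\<exists>g. integrable lborel g \<and> (AE x in lborel. pv_cauchy g x)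
        \<and> (LINT y|lborel. cmod (f y - g y)) \<le> \<delta>"
      using s by (intro exI[of _ "s i"]) auto
  qed
qed

text \<open>
The functions \<open>min 1 (i * dist y (- U))\<close> are Lipschitz and increase to the indicator of \<open>U\<close>.
\<close>

lemma pv_cauchy_indicator_open:
  assumes U: "open U" "emeasure lborel U < \<infinity>"
  shows "AE x in lborel. pv_cauchy (\<lambda>y. indicator U y *\<^sub>R c) x"
proof -
  have ne: "- U \<noteq> {}"
  proof
    assume "- U = {}"
    then have "U = UNIV" by blast
    with U(2) show False by simp
  qed
  define h :: "nat \<Rightarrow> real \<Rightarrow> real" where "h i y = min 1 (real i * infdist y (- U))" for i y
  have h0: "0 \<le> h i y" "h i y \<le> indicator U y" for i y
    by (auto simp: h_def infdist_nonneg indicator_def)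
  have hm: "h i \<in> borel_measurable borel" for i
    unfolding h_def[abs_def] by (intro borel_measurable_continuous_onI continuous_intros)
  have intU: "integrable lborel (\<lambda>y. indicator U y * cmod c)"
    using U by (intro Bochner_Integration.integrable_mult_left integrable_real_indicator) auto
  have bound: "cmod (h i y *\<^sub>R c) \<le> indicator U y * cmod c" for i y
    using h0[of i y] by (auto intro!: mult_right_mono)
  have hint: "integrable lborel (\<lambda>y. h i y *\<^sub>R c)" for i
  proof (rule Bochner_Integration.integrable_bound[OF intU])
    show "AE y in lborel. norm (h i y *\<^sub>R c) \<le> norm (indicator U y * cmod c)"
      using bound by (intro AE_I2) (simp add: indicator_def)
  qed (use hm in simp)
  have lip: "cmod (h i u *\<^sub>R c - h i v *\<^sub>R c) \<le> (real i * cmod c) * \<bar>u - v\<bar>" for i u v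
  proof -
    have "\<bar>h i u - h i v\<bar> \<le> \<bar>real i * infdist u (- U) - real i * infdist v (- U)\<bar>"
      by (auto simp: h_def min_def)
    also have "\<dots> \<le> real i * \<bar>u - v\<bar>"
      using infdist_triangle_abs[of u "- U" v]
      by (simp add: right_diff_distrib[symmetric] abs_mult dist_real_def mult_left_mono)
    finally have "\<bar>h i u - h i v\<bar> * cmod c \<le> (real i * \<bar>u - v\<bar>) * cmod c"
      by (intro mult_right_mono) auto
    then show ?thesis by (simp add: scaleR_diff_left[symmetric] mult_ac)
  qed
  show ?thesis
  proof (rule pv_cauchy_dominated_limit[where s = "\<lambda>i y. h i y *\<^sub>R c"
        and w = "\<lambda>y. indicator U y * cmod c"])
    show "(\<lambda>i. h i y *\<^sub>R c) \<longlonglongrightarrow> indicator U y *\<^sub>R c" for y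
    proof (cases "y \<in> U")
      case True
      then have "0 < infdist y (- U)"
        using U(1) ne by (metis Compl_iff closed_Compl infdist_pos_not_in_closed)
      then obtain N where N: "1 < real N * infdist y (- U)"
        using reals_Archimedean3 by blast
      have "eventually (\<lambda>i. 1 = h i y) sequentially"
        using eventually_ge_at_top[of N]
      proof eventually_elim
        case (elim i)
        have "real N * infdist y (- U) \<le> real i * infdist y (- U)"
          using elim by (intro mult_right_mono) (auto simp: infdist_nonneg)
        then show ?case using N by (simp add: h_def)
      qed
      then have "(\<lambda>i. h i y) \<longlonglongrightarrow> 1"
        by (rule Lim_transform_eventually[OF tendsto_const])
      then show ?thesis using True by (intro tendsto_scaleR tendsto_const) simp
    next
      case False
      then have "h i y = 0" for i by (simp add: h_def)
      then show ?thesis using False by simp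
    qed
    show "AE x in lborel. pv_cauchy (\<lambda>y. h i y *\<^sub>R c) x" for i
      by (intro AE_I2 pv_cauchy_lipschitz[OF hint lip])
    show "(\<lambda>y. indicator U y *\<^sub>R c) \<in> borel_measurable lborel"
      using U(1) by simp
  qed (rule hint intU bound)+
qed

lemma pv_cauchy_AE:
  assumes "integrable lborel f"
  shows "AE x in lborel. pv_cauchy f x"
  using assms
proof (induction rule: integrable_induct)
  case (base A c)
  have A: "A \<in> sets lebesgue" "A \<in> sets borel" using base by auto
  show ?case
  proof (rule pv_cauchy_L1_closed)
    show "integrable lborel (\<lambda>x. indicator A x *\<^sub>R c)"
      using base by (intro integrable_scaleR_left integrable_real_indicator) auto
    fix \<delta> :: real assume "0 < \<delta>"
    define e where "e = \<delta> / (cmod c + 1)"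
    have "0 < e" using \<open>0 < \<delta>\<close> by (simp add: e_def add_nonneg_pos)
    \<comment> \<open>outer regularity reduces a measurable set to an open one\<close>
    obtain U where U: "open U" "A \<subseteq> U" "U - A \<in> lmeasurable" "emeasure lebesgue (U - A) < ennreal e"
      using sets_lebesgue_outer_open[OF A(1) \<open>0 < e\<close>] by blast
    have UA: "emeasure lborel (U - A) < ennreal e" using U A by simp
    have "emeasure lborel U \<le> emeasure lborel A + emeasure lborel (U - A)"
      using emeasure_subadditive[of A lborel "U - A"] U A by (simp add: Un_absorb1)
    also have "\<dots> < \<infinity>" using base UA by (auto simp: less_top[symmetric] top_unique)
    finally have fin: "emeasure lborel U < \<infinity>" .
    have "(LINT y|lborel. cmod (indicator A y *\<^sub>R c - indicator U y *\<^sub>R c))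
        = (LINT y|lborel. indicator (U - A) y * cmod c)"
      using U(2) by (intro Bochner_Integration.integral_cong) (auto simp: indicator_def)
    also have "\<dots> = measure lborel (U - A) * cmod c" by simp
    also have "\<dots> \<le> e * (cmod c + 1)"
      using UA \<open>0 < e\<close> by (intro mult_mono) (auto simp: measure_def enn2real_leI less_imp_le)
    also have "\<dots> = \<delta>" by (simp add: e_def add_nonneg_eq_0_iff)
    finally show "\<exists>g. integrable lborel g \<and> (AE x in lborel. pv_cauchy g x)
        \<and> (LINT y|lborel. cmod (indicator A y *\<^sub>R c - g y)) \<le> \<delta>"
      using pv_cauchy_indicator_open[OF U(1) fin] U(1) fin
      by (intro exI[of _ "\<lambda>y. indicator U y *\<^sub>R c"] conjI integrable_scaleR_left integrable_real_indicator) auto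
  qed
next
  case (add f g)
  from add.IH show ?case
    by eventually_elim (rule pv_cauchy_add[OF add.hyps])
next
  case (lim f s)
  show ?case
  proof (rule pv_cauchy_dominated_limit[where s = s and w = "\<lambda>y. 2 * cmod (f y)"])
  qed (use lim in auto)
qed

section \<open>Superlevel sets of the Hilbert transform at small heights\<close>

text \<open>
Since \<open>1 / (y - x) = - 1 / x + y / (x * (y - x))\<close>, the transform agrees with that of a point mass at the
origin up to an error of order \<open>1 / x\<^sup>2\<close>.
\<close>

lemma trunc_hilbert_far_field:
  fixes g :: "real \<Rightarrow> complex"
  assumes g: "integrable lborel g" and supp: "\<And>y. R < \<bar>y\<bar> \<Longrightarrow> g y = 0"
    and R: "0 \<le> R" "R < x" and e: "0 < \<epsilon>" "\<epsilon> < x - R"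
  shows "cmod (trunc_hilbert g \<epsilon> x + (1 / x) *\<^sub>R (LINT y|lborel. g y))
    \<le> R / (x * (x - R)) * (LINT y|lborel. cmod (g y))"
proof -
  have "trunc_hilbert g \<epsilon> x + (1 / x) *\<^sub>R (LINT y|lborel. g y)
      = (LINT y|lborel. hilbert_kernel \<epsilon> (y - x) *\<^sub>R g y + (1 / x) *\<^sub>R g y)"
    unfolding trunc_hilbert_def
    using integrable_hilbert_kernel[OF g e(1), of x] g by simp
  also have "cmod \<dots> \<le> (LINT y|lborel. R / (x * (x - R)) * cmod (g y))"
  proof (rule Bochner_Integration.integral_norm_bound_integral)
    show "integrable lborel (\<lambda>y. hilbert_kernel \<epsilon> (y - x) *\<^sub>R g y + (1 / x) *\<^sub>R g y)"
      using integrable_hilbert_kernel[OF g e(1), of x] g by simp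
    show "integrable lborel (\<lambda>y. R / (x * (x - R)) * cmod (g y))" using g by simp
    fix y
    show "norm (hilbert_kernel \<epsilon> (y - x) *\<^sub>R g y + (1 / x) *\<^sub>R g y) \<le> R / (x * (x - R)) * cmod (g y)"
    proof (cases "R < \<bar>y\<bar>")
      case True
      then show ?thesis using supp by simp
    next
      case False
      then have y: "\<bar>y\<bar> \<le> R" "x - R \<le> x - y" by auto
      have "hilbert_kernel \<epsilon> (y - x) = 1 / (y - x)"
        using y e by (auto simp: hilbert_kernel_def)
      then have "hilbert_kernel \<epsilon> (y - x) + 1 / x = - (y / (x * (x - y)))"
        using y R by (simp add: divide_simps) (simp add: algebra_simps)
      then have "\<bar>hilbert_kernel \<epsilon> (y - x) + 1 / x\<bar> = \<bar>y\<bar> / (x * (x - y))"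
        using y R by (simp add: abs_mult)
      also have "\<dots> \<le> R / (x * (x - R))"
        using y R by (intro frac_le mult_left_mono mult_pos_pos) auto
      finally have "\<bar>hilbert_kernel \<epsilon> (y - x) + 1 / x\<bar> * cmod (g y) \<le> R / (x * (x - R)) * cmod (g y)"
        by (intro mult_right_mono) auto
      then show ?thesis by (simp add: scaleR_add_left[symmetric])
    qed
  qed
  finally show ?thesis by simp
qed

lemma truncation_L1_small:
  fixes g :: "real \<Rightarrow> complex"
  assumes g: "integrable lborel g" and "0 < \<delta>"
  obtains R where "0 \<le> R" "(LINT y|lborel. cmod (g y - indicator {-R..R} y *\<^sub>R g y)) < \<delta>"
proof -
  have gm: "g \<in> borel_measurable lborel" using g by (rule borel_measurable_integrable)
  have "(\<lambda>n. LINT y|lborel. cmod (g y - indicator {-real n..real n} y *\<^sub>R g y))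
      \<longlonglongrightarrow> (LINT y|(lborel :: real measure). 0)"
  proof (rule integral_dominated_convergence[where w = "\<lambda>y. cmod (g y)"])
    show "AE y in lborel. (\<lambda>n. cmod (g y - indicator {-real n..real n} y *\<^sub>R g y)) \<longlonglongrightarrow> 0"
    proof (rule AE_I2)
      fix y
      obtain N :: nat where N: "\<bar>y\<bar> \<le> real N" using real_arch_simple by blast
      have "eventually (\<lambda>n. 0 = cmod (g y - indicator {-real n..real n} y *\<^sub>R g y)) sequentially"
        using eventually_ge_at_top[of N] by eventually_elim (use N in \<open>auto simp: indicator_def\<close>)
      then show "(\<lambda>n. cmod (g y - indicator {-real n..real n} y *\<^sub>R g y)) \<longlonglongrightarrow> 0"
        by (rule Lim_transform_eventually[OF tendsto_const])
    qed
    show "AE y in lborel. norm (cmod (g y - indicator {-real n..real n} y *\<^sub>R g y)) \<le> cmod (g y)" for n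
      by (intro AE_I2) (simp add: indicator_def)
  qed (use g gm in auto)
  then have "(\<lambda>n. LINT y|lborel. cmod (g y - indicator {-real n..real n} y *\<^sub>R g y)) \<longlonglongrightarrow> 0"
    by simp
  from order_tendstoD(2)[OF this \<open>0 < \<delta>\<close>] eventually_happens'[OF sequentially_bot] obtain n
    where "(LINT y|lborel. cmod (g y - indicator {-real n..real n} y *\<^sub>R g y)) < \<delta>" by blast
  then show ?thesis using that[of "real n"] by simp
qed

lemma superlevel_measurable:
  fixes h :: "real \<Rightarrow> complex"
  assumes [measurable]: "h \<in> borel_measurable lebesgue"
  shows "{x. t < cmod (h x)} \<in> sets lebesgue"
proof -
  have "{x \<in> space lebesgue. t < cmod (h x)} \<in> sets lebesgue" by measurable
  then show ?thesis by simp
qed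

text \<open>
On \<open>[X, a / (12 * t)]\<close>, with \<open>a = \<bar>\<integral> g\<bar>\<close>, the part of \<open>g\<close> with bounded support has truncations of modulus at
least \<open>3 * t\<close>. The truncations of the remainder are at most \<open>t\<close> outside an exceptional set of measure at most
\<open>a / (48 * t)\<close>, a quarter of the length \<open>a / (12 * t)\<close>; half of that length remains once \<open>X * t\<close> is small,
which leaves room for the constant \<open>a / 48\<close>.
\<close>

lemma superlevel_lower_bound:
  fixes g H :: "real \<Rightarrow> complex"
  assumes g: "integrable lborel g" and "(LINT y|lborel. g y) \<noteq> 0"
    and H: "AE x in lborel. ((\<lambda>\<epsilon>. trunc_hilbert g \<epsilon> x) \<longlongrightarrow> H x) (at_right 0)"
    and Hm: "H \<in> borel_measurable lebesgue"
    and fin: "\<And>t. 0 < t \<Longrightarrow> emeasure lebesgue {x. t < cmod (H x)} < \<infinity>"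
  shows "\<exists>c>0. eventually (\<lambda>t. c \<le> t * measure lebesgue {x. t < cmod (H x)}) (at_right 0)"
proof -
  define a N where "a = cmod (LINT y|lborel. g y)" and "N = (LINT y|lborel. cmod (g y))"
  have "0 < a" using assms(2) by (simp add: a_def)
  have "0 \<le> N" by (simp add: N_def)
  \<comment> \<open>makes the exceptional set of the remainder at height \<open>t\<close> of measure at most \<open>a / (48 * t)\<close>\<close>
  define \<delta> where "\<delta> = a / (1920 * 48)"
  have "0 < \<delta>" using \<open>0 < a\<close> by (simp add: \<delta>_def)
  obtain R where R: "0 \<le> R" "(LINT y|lborel. cmod (g y - indicator {-R..R} y *\<^sub>R g y)) < \<delta>"
    using truncation_L1_small[OF g \<open>0 < \<delta>\<close>] by blast
  define g1 g2 where "g1 y = indicator {-R..R} y *\<^sub>R g y" and "g2 y = g y - g1 y" for y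
  have int1: "integrable lborel g1"
    unfolding g1_def[abs_def] using g by (intro integrable_bounded_mult[where c = 1]) auto
  have int2: "integrable lborel g2" unfolding g2_def[abs_def] using g int1 by simp
  have I2: "(LINT y|lborel. cmod (g2 y)) < \<delta>" using R(2) by (simp add: g1_def g2_def)
  have I1: "a / 2 \<le> cmod (LINT y|lborel. g1 y)"
  proof -
    have "(LINT y|lborel. g1 y) = (LINT y|lborel. g y) - (LINT y|lborel. g2 y)"
      using g int1 by (simp add: g2_def)
    moreover have "cmod (LINT y|lborel. g2 y) \<le> \<delta>"
      by (rule order_trans[OF integral_norm_bound less_imp_le[OF I2]])
    ultimately have "a - \<delta> \<le> cmod (LINT y|lborel. g1 y)"
      using norm_triangle_ineq2[of "LINT y|lborel. g y" "LINT y|lborel. g2 y"] by (simp add: a_def)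
    then show ?thesis using \<open>0 < a\<close> by (simp add: \<delta>_def)
  qed
  have N1: "(LINT y|lborel. cmod (g1 y)) \<le> N"
    unfolding N_def
    by (intro integral_mono integrable_norm g int1) (simp add: g1_def indicator_def)
  \<comment> \<open>beyond \<open>X\<close> the error of the far field is at most half of the lower bound \<open>a / (2 * x)\<close> for its main term\<close>
  define X where "X = R + 1 + 4 * R * N / a"
  have "R < X" using R(1) \<open>0 \<le> N\<close> \<open>0 < a\<close> by (simp add: X_def add_pos_nonneg)
  have far: "a / (4 * x) \<le> cmod (trunc_hilbert g1 \<epsilon> x)" if x: "X \<le> x" and e: "0 < \<epsilon>" "\<epsilon> < x - R" for x \<epsilon>
  proof -
    have pos: "0 < x" "0 < x - R" using x R(1) \<open>R < X\<close> by auto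
    have "4 * R * N / a \<le> x - R" using x by (simp add: X_def)
    then have RN: "R * N / (x - R) \<le> a / 4" using pos \<open>0 < a\<close> by (simp add: field_simps)
    have "cmod (trunc_hilbert g1 \<epsilon> x + (1 / x) *\<^sub>R (LINT y|lborel. g1 y))
        \<le> R / (x * (x - R)) * (LINT y|lborel. cmod (g1 y))"
      using pos R(1) e by (intro trunc_hilbert_far_field[OF int1]) (auto simp: g1_def indicator_def)
    also have "\<dots> \<le> R / (x * (x - R)) * N"
      using N1 pos R(1) by (intro mult_left_mono) auto
    also have "\<dots> = (R * N / (x - R)) / x" using pos by (simp add: field_simps)
    also have "\<dots> \<le> (a / 4) / x" using RN pos by (intro divide_right_mono) auto
    finally have "cmod (trunc_hilbert g1 \<epsilon> x + (1 / x) *\<^sub>R (LINT y|lborel. g1 y)) \<le> (a / 4) / x" .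
    moreover have "(a / 2) / x \<le> cmod ((1 / x) *\<^sub>R (LINT y|lborel. g1 y))"
      using divide_right_mono[OF I1, of x] pos by simp
    ultimately have "(a / 2) / x - (a / 4) / x \<le> cmod (trunc_hilbert g1 \<epsilon> x)"
      using norm_triangle_ineq4[of "trunc_hilbert g1 \<epsilon> x + (1 / x) *\<^sub>R (LINT y|lborel. g1 y)" "trunc_hilbert g1 \<epsilon> x"]
      by simp
    then show ?thesis by (simp add: diff_divide_distrib[symmetric])
  qed
  have main: "a / 48 \<le> t * measure lebesgue {x. t < cmod (H x)}" if t: "0 < t" "X * t < a / 24" for t
  proof -
    define E where "E = {x. t < cmod (H x)}"
    define B where "B = {x. \<exists>\<epsilon>>0. t < cmod (trunc_hilbert g2 \<epsilon> x)}"
    define Z where "Z = {x. \<not> ((\<lambda>\<epsilon>. trunc_hilbert g \<epsilon> x) \<longlongrightarrow> H x) (at_right 0)}"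
    have E: "E \<in> lmeasurable"
      using fin[OF t(1)] superlevel_measurable[OF Hm] unfolding E_def fmeasurable_def by simp
    have "outer_measure_le B (1920 * (LINT y|lborel. cmod (g2 y)) / t)"
      unfolding B_def using int2 t(1) by (rule trunc_hilbert_maximal)
    from outer_measure_le_Un[OF this AE_imp_outer_le_0[OF H]]
    obtain C where C: "C \<in> fmeasurable lborel" "B \<union> Z \<subseteq> C"
        "measure lborel C \<le> 1920 * (LINT y|lborel. cmod (g2 y)) / t"
      unfolding outer_measure_le_def Z_def by auto
    have "1920 * (LINT y|lborel. cmod (g2 y)) / t \<le> (a / 48) / t"
      using I2 t(1) by (intro divide_right_mono) (auto simp: \<delta>_def)
    with C have C': "C \<in> lmeasurable" "measure lebesgue C \<le> (a / 48) / t"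
      by (auto simp: fmeasurable_def measure_completion)
    have "{X..a / (12 * t)} \<subseteq> E \<union> C"
    proof (rule subsetI, rule ccontr)
      fix x assume x: "x \<in> {X..a / (12 * t)}" and n: "x \<notin> E \<union> C"
      then have "x \<notin> B" "x \<notin> Z" using C(2) by auto
      have "0 < x" using x R(1) \<open>R < X\<close> by auto
      have "3 * t \<le> a / (4 * x)"
        using x \<open>0 < x\<close> t(1) by (simp add: field_simps)
      have lower: "2 * t \<le> cmod (trunc_hilbert g \<epsilon> x)" if e: "0 < \<epsilon>" "\<epsilon> < x - R" for \<epsilon>
      proof -
        have "cmod (trunc_hilbert g2 \<epsilon> x) \<le> t" using \<open>x \<notin> B\<close> e(1) by (force simp: B_def)
        moreover have "3 * t \<le> cmod (trunc_hilbert g1 \<epsilon> x)"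
          using far[OF _ e] x \<open>3 * t \<le> a / (4 * x)\<close> by force
        moreover have "trunc_hilbert g2 \<epsilon> x = trunc_hilbert g \<epsilon> x - trunc_hilbert g1 \<epsilon> x"
          using trunc_hilbert_diff[OF g int1 e(1), of x] by (simp add: g2_def[abs_def])
        ultimately show ?thesis
          using norm_triangle_ineq2[of "trunc_hilbert g1 \<epsilon> x" "trunc_hilbert g \<epsilon> x"]
          by (simp add: norm_minus_commute)
      qed
      have "eventually (\<lambda>\<epsilon>. \<epsilon> \<in> {0<..<x - R}) (at_right 0)"
        using x \<open>R < X\<close> by (intro eventually_at_right_real) auto
      then have "eventually (\<lambda>\<epsilon>. 2 * t \<le> cmod (trunc_hilbert g \<epsilon> x)) (at_right 0)"
        by eventually_elim (use lower in auto)
      moreover have "((\<lambda>\<epsilon>. cmod (trunc_hilbert g \<epsilon> x)) \<longlongrightarrow> cmod (H x)) (at_right 0)"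
        using \<open>x \<notin> Z\<close> by (intro tendsto_norm) (simp add: Z_def)
      ultimately have "2 * t \<le> cmod (H x)"
        by (intro tendsto_lowerbound) auto
      then show False using n t(1) by (auto simp: E_def)
    qed
    then have "measure lebesgue {X..a / (12 * t)} \<le> measure lebesgue (E \<union> C)"
      using E C'(1) by (intro measure_mono_fmeasurable) auto
    also have "\<dots> \<le> measure lebesgue E + (a / 48) / t"
      using measure_Un_le[of E lebesgue C] E C' by (auto simp: fmeasurableD)
    finally have "measure lebesgue {X..a / (12 * t)} \<le> measure lebesgue E + (a / 48) / t" .
    moreover have "a / (12 * t) - X \<le> measure lebesgue {X..a / (12 * t)}"
      by (cases "X \<le> a / (12 * t)") auto
    ultimately have "a / (12 * t) - X \<le> measure lebesgue E + (a / 48) / t" by linarith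
    from mult_left_mono[OF this, of t] show ?thesis
      using t by (simp add: E_def algebra_simps)
  qed
  show ?thesis
  proof (intro exI[of _ "a / 48"] conjI)
    have "((\<lambda>t. X * t) \<longlongrightarrow> X * 0) (at_right 0)" by (intro tendsto_intros)
    then have "eventually (\<lambda>t. X * t < a / 24) (at_right 0)"
      using \<open>0 < a\<close> by (intro order_tendstoD(2)) auto
    then show "eventually (\<lambda>t. a / 48 \<le> t * measure lebesgue {x. t < cmod (H x)}) (at_right 0)"
      using eventually_at_right_less[of 0] by eventually_elim (rule main)
  qed (use \<open>0 < a\<close> in simp)
qed

text \<open>
Dominated convergence: \<open>t\<close> times the indicator of \<open>\<bar>h\<bar> > t\<close> is at most \<open>\<bar>h\<bar>\<close> and at most \<open>t\<close>.
\<close>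

lemma integrable_superlevel_tendsto_0:
  fixes h :: "real \<Rightarrow> complex"
  assumes h: "integrable lebesgue h"
  shows "(\<lambda>n. 1 / real (Suc n) * measure lebesgue {x. 1 / real (Suc n) < cmod (h x)}) \<longlonglongrightarrow> 0"
proof -
  have hm: "h \<in> borel_measurable lebesgue" using h by (rule borel_measurable_integrable)
  let ?E = "\<lambda>n. {x. 1 / real (Suc n) < cmod (h x)}"
  have Em: "?E n \<in> sets lebesgue" for n
    by (rule superlevel_measurable[OF hm])
  have lim: "(\<lambda>n. 1 / real (Suc n)) \<longlonglongrightarrow> 0" by real_asymp
  have "(\<lambda>n. LINT x|lebesgue. 1 / real (Suc n) * indicator (?E n) x) \<longlonglongrightarrow> (LINT x|(lebesgue :: real measure). 0)"
  proof (rule integral_dominated_convergence[where w = "\<lambda>x. cmod (h x)"])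
    show "AE x in lebesgue. (\<lambda>n. 1 / real (Suc n) * indicator (?E n) x) \<longlonglongrightarrow> (0 :: real)"
    proof (rule AE_I2, rule tendsto_sandwich[OF _ _ tendsto_const lim])
      fix x
      show "eventually (\<lambda>n. 0 \<le> 1 / real (Suc n) * indicator (?E n) x) sequentially"
        "eventually (\<lambda>n. 1 / real (Suc n) * indicator (?E n) x \<le> 1 / real (Suc n)) sequentially"
        by (auto intro!: always_eventually simp: indicator_def)
    qed
    show "AE x in lebesgue. norm (1 / real (Suc n) * indicator (?E n) x :: real) \<le> cmod (h x)" for n
      by (intro AE_I2) (auto simp: indicator_def)
  qed (use h Em in auto)
  then show ?thesis using Em by simp
qed

lemma lebesgue_measurable_AE_eq_borel:
  fixes f :: "real \<Rightarrow> complex"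
  assumes f: "f \<in> borel_measurable lebesgue"
  shows "\<exists>g \<in> borel_measurable lborel. AE y in lebesgue. f y = g y"
proof -
  have "(\<lambda>y. Re (f y)) \<in> borel_measurable lebesgue" "(\<lambda>y. Im (f y)) \<in> borel_measurable lebesgue"
    using f by auto
  then obtain u v where uv: "u \<in> borel_measurable lborel" "v \<in> borel_measurable lborel"
    "AE y in lborel. Re (f y) = u y" "AE y in lborel. Im (f y) = v y"
    by (auto dest!: completion_ex_borel_measurable_real)
  have ae: "AE y in lborel. f y = complex_of_real (u y) + \<i> * complex_of_real (v y)"
    using uv(3,4) by eventually_elim (simp add: complex_eq_iff)
  have "(\<lambda>y. complex_of_real (u y) + \<i> * complex_of_real (v y)) \<in> borel_measurable lborel"
    using uv(1,2) by simp
  with AE_completion[OF ae] show ?thesis by (rule bexI)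
qed

text \<open>
Passing to a Borel representative does not change any truncated integral, and so it does not change the
Hilbert transform at any point, not even where the limit fails to exist.
\<close>

lemma hilbert_transform_eq_trunc:
  assumes f: "f \<in> borel_measurable lebesgue" and g: "g \<in> borel_measurable lborel"
    and eq: "AE y in lebesgue. f y = g y"
  shows "set_lebesgue_integral lebesgue {y. \<epsilon> < \<bar>y - x\<bar>} (\<lambda>y. f y / complex_of_real (y - x))
    = trunc_hilbert g \<epsilon> x"
proof -
  have k: "(\<lambda>y. hilbert_kernel \<epsilon> (y - x)) \<in> borel_measurable lborel" by measurable
  have "set_lebesgue_integral lebesgue {y. \<epsilon> < \<bar>y - x\<bar>} (\<lambda>y. f y / complex_of_real (y - x))
      = (LINT y|lebesgue. hilbert_kernel \<epsilon> (y - x) *\<^sub>R f y)"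
    unfolding set_lebesgue_integral_def
    by (intro Bochner_Integration.integral_cong) (auto simp: hilbert_kernel_def indicator_def scaleR_conv_of_real)
  also have "\<dots> = (LINT y|lebesgue. hilbert_kernel \<epsilon> (y - x) *\<^sub>R g y)"
    using eq by (intro integral_cong_AE borel_measurable_scaleR f measurable_completion[OF g]
        measurable_completion[OF k]) auto
  also have "\<dots> = trunc_hilbert g \<epsilon> x"
    unfolding trunc_hilbert_def using k g by (intro integral_completion) auto
  finally show ?thesis .
qed

theorem theorem6p2:
  fixes f :: "real \<Rightarrow> complex"
  assumes "integrable lebesgue f"
    and "integral\<^sup>L lebesgue f \<noteq> 0"
  shows "hilbert_transform f \<notin> weak_L1_0 \<and> \<not> integrable lebesgue (hilbert_transform f)"
proof -
  have fm: "f \<in> borel_measurable lebesgue"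
    using assms(1) by (rule borel_measurable_integrable)
  obtain g where gm: "g \<in> borel_measurable lborel" and ae: "AE y in lebesgue. f y = g y"
    using lebesgue_measurable_AE_eq_borel[OF fm] by blast
  have g: "integrable lborel g" and gI: "(LINT y|lborel. g y) \<noteq> 0"
  proof -
    have gl: "g \<in> borel_measurable lebesgue" using gm by (rule measurable_completion)
    have "integrable lebesgue g"
      using assms(1) integrable_cong_AE[OF fm gl ae] by simp
    then show "integrable lborel g" using integrable_completion[OF gm] by simp
    show "(LINT y|lborel. g y) \<noteq> 0"
      using assms(2) integral_cong_AE[OF fm gl ae] integral_completion[OF gm] by simp
  qed
  define H where "H = hilbert_transform f"
  have lim: "AE x in lborel. ((\<lambda>\<epsilon>. trunc_hilbert g \<epsilon> x) \<longlongrightarrow> H x) (at_right 0)"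
    using pv_cauchy_AE[OF g]
  proof eventually_elim
    case (elim x)
    then obtain l where l: "((\<lambda>\<epsilon>. trunc_hilbert g \<epsilon> x) \<longlongrightarrow> l) (at_right 0)"
      using pv_cauchy_imp_convergent by blast
    moreover have "H x = Lim (at_right 0) (\<lambda>\<epsilon>. trunc_hilbert g \<epsilon> x)"
      unfolding H_def hilbert_transform_def pv_integral_def hilbert_transform_eq_trunc[OF fm gm ae] ..
    ultimately show ?case
      using tendsto_Lim[OF trivial_limit_at_right_real l] by simp
  qed
  have lower: "\<exists>c>0. eventually (\<lambda>t. c \<le> t * measure lebesgue {x. t < cmod (H x)}) (at_right 0)"
    if "H \<in> borel_measurable lebesgue" "\<And>t. 0 < t \<Longrightarrow> emeasure lebesgue {x. t < cmod (H x)} < \<infinity>"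
    using superlevel_lower_bound[OF g gI lim that] .
  have "H \<notin> weak_L1_0"
  proof
    assume H: "H \<in> weak_L1_0"
    then obtain c where c: "0 < c"
        "eventually (\<lambda>t. c \<le> t * measure lebesgue {x. t < cmod (H x)}) (at_right 0)"
      using lower unfolding weak_L1_0_def by blast
    have "(\<lambda>t. measure lebesgue {x. t < cmod (H x)}) \<in> o[at_right 0](\<lambda>t. 1 / t)"
      using H unfolding weak_L1_0_def by blast
    then have "eventually (\<lambda>t. norm (measure lebesgue {x. t < cmod (H x)}) \<le> c / 2 * norm (1 / t)) (at_right 0)"
      using c(1) by (intro landau_o.smallD) auto
    with c(2) eventually_at_right_less[of 0] have "eventually (\<lambda>t::real. False) (at_right 0)"
    proof eventually_elim
      case (elim t)
      then have "t * measure lebesgue {x. t < cmod (H x)} \<le> c / 2"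
        by (simp add: field_simps)
      then show False using elim(1) c(1) by simp
    qed
    then show False by (simp add: trivial_limit_at_right_real)
  qed
  moreover have "\<not> integrable lebesgue H"
  proof
    assume H: "integrable lebesgue H"
    have "emeasure lebesgue {x. t < cmod (H x)} < \<infinity>" if "0 < t" for t
    proof -
      have "emeasure lebesgue {x. t < cmod (H x)} \<le> emeasure lebesgue {x \<in> space lebesgue. t \<le> cmod (H x)}"
      proof (rule emeasure_mono)
        have [measurable]: "H \<in> borel_measurable lebesgue"
          using H by (rule borel_measurable_integrable)
        show "{x \<in> space lebesgue. t \<le> cmod (H x)} \<in> sets lebesgue" by measurable
      qed auto
      also have "\<dots> \<le> ennreal (1 / t * (LINT x|lebesgue. cmod (H x)))"
        using H that by (intro integral_Markov_inequality) auto
      finally show ?thesis by (rule le_less_trans) simp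
    qed
    then obtain c where c: "0 < c"
        "eventually (\<lambda>t. c \<le> t * measure lebesgue {x. t < cmod (H x)}) (at_right 0)"
      using lower[OF borel_measurable_integrable[OF H]] by blast
    have "filterlim (\<lambda>n. 1 / real (Suc n)) (at_right 0) sequentially" by real_asymp
    then have "eventually (\<lambda>n. c \<le> 1 / real (Suc n) * measure lebesgue {x. 1 / real (Suc n) < cmod (H x)}) sequentially"
      by (rule eventually_compose_filterlim[OF c(2)])
    then have "c \<le> 0"
      using integrable_superlevel_tendsto_0[OF H] by (intro tendsto_lowerbound) auto
    then show False using c(1) by simp
  qed
  ultimately show ?thesis by (simp add: H_def)
qed

end
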